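(* Let $F$ be a $C^\infty$ function defined on an open subset of $\mathbb{R}^{n+1}$ and let $\Omega$ be a connected component with nonempty interior of the region on which $\mathsf U(F)$ does not vanish. Then the equiaffine normal of a nonempty level set $\Sigma_r(F,\Omega)=\{x\in\Omega:F(x)=r\}$ consistent with the co-orientation determined by $-\operatorname{sgn}(\mathsf U(F))N^i$ is given by $$\mathsf W^i=-|\mathsf U(F)|^{1/(n+2)}\,\mathsf U(F)^{-1}N^i-k^{ip}\mu_p .$$
   Context: $\mathbb{R}^{n+1}$ has its standard flat connection $\hat\nabla$ and parallel volume form $\Psi=dx^1\wedge\dots\wedge dx^{n+1}$. In the coordinates $x^i$: $F_i$ and $F_{ij}$ are the first and second partial derivatives of $F$, $\mathsf H(F)=\det(F_{ij})$, $U^{ij}$ is the adjugate matrix of $(F_{ij})$ (so $U^{ip}F_{pj}=\mathsf H(F)\delta_j{}^i$), $N^i=U^{ip}F_p$, $\mathsf U(F)=U^{ij}F_iF_j$. Summation convention is used. Where $\mathsf U(F)\ne0$: $\Pi_{ij}=F_{ij}-\mathsf U(F)^{-1}\mathsf H(F)F_iF_j$; for any nonvanishing smooth function $q$ the tensor $m_{ij}=\Pi_{ij}+q\,\mathsf U(F)^{-1}F_iF_j$ is nondegenerate with inverse $m^{ij}$, and $\Pi^{ij}=m^{ij}-q^{-1}\mathsf U(F)^{-1}N^iN^j$, which does not depend on $q$. Further $k^{ij}=|\mathsf U(F)|^{1/(n+2)}\Pi^{ij}$ and $\mu=(n+2)^{-1}d\log|\mathsf U(F)|$. The level sets of $F$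 in $\Omega$ are nondegenerate hypersurfaces transverse to $N$. A transversal $T$ to a hypersurface $\Sigma$ determines an induced connection $\nabla$, symmetric tensor $h$, and $S,\tau$ by $\hat\nabla_XY=\nabla_XY+h(X,Y)T$, $\hat\nabla_XT=-S(X)+\tau(X)T$ for $X,Y$ tangent to $\Sigma$; $\Sigma$ is nondegenerate if $h$ is nondegenerate. The equiaffine normal of a co-oriented nondegenerate hypersurface is the unique co-oriented transversal $\mathsf W$ such that the volume density $|\iota(\mathsf W)\Psi|$ equals the volume density of the corresponding $h$ and is parallel with respect to the corresponding induced connection $\nabla$. *)

theory Defs
  imports "HOL-Analysis.Analysis"
begin

text \<open>
  Throughout, \<open>n = CARD('m)\<close> and \<open>real ^ ('m option)\<close> is the space of dimension \<open>n + 1\<close>.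
  Indexing the coordinates by \<open>'m option\<close> lets \<open>n\<close>-tuples of vectors (indexed by \<open>'m\<close>) be completed
  by one further vector (index \<open>None\<close>) to an \<open>(n + 1)\<close>-tuple.  All types being nonempty, \<open>n \<ge> 1\<close>.
\<close>

section \<open>Smooth functions\<close>

primrec Ck_on :: "nat \<Rightarrow> 'a::real_normed_vector set \<Rightarrow> ('a \<Rightarrow> 'b::real_normed_vector) \<Rightarrow> bool" where
  "Ck_on 0 S f \<longleftrightarrow> continuous_on S f"
| "Ck_on (Suc k) S f \<longleftrightarrow>
     (\<forall>x\<in>S. f differentiable (at x)) \<and> (\<forall>v. Ck_on k S (\<lambda>x. frechet_derivative f (at x) v))"

text \<open>This is the usual notion when \<open>S\<close> is open and the domain is finite-dimensional, which is the
  only case in which it is used.\<close>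

definition smooth_on :: "'a::euclidean_space set \<Rightarrow> ('a \<Rightarrow> 'b::real_normed_vector) \<Rightarrow> bool" where
  "smooth_on S f \<longleftrightarrow> (\<forall>k. Ck_on k S f)"

section \<open>Hypersurfaces and transversals\<close>

definition hypersurface :: "'a::euclidean_space set \<Rightarrow> bool" where
  "hypersurface \<Sigma> \<longleftrightarrow>
     (\<forall>p\<in>\<Sigma>. \<exists>V (f :: 'a \<Rightarrow> real). open V \<and> p \<in> V \<and> smooth_on V f \<and>
        (\<forall>x\<in>V. frechet_derivative f (at x) \<noteq> (\<lambda>_. 0)) \<and> \<Sigma> \<inter> V = {x \<in> V. f x = 0})"

definition tangent_space :: "'a::euclidean_space set \<Rightarrow> 'a \<Rightarrow> 'a set" where
  "tangent_space \<Sigma> p =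
     {v. \<exists>\<gamma> \<epsilon>. 0 < \<epsilon> \<and> smooth_on {-\<epsilon><..<\<epsilon>} \<gamma> \<and> \<gamma> ` {-\<epsilon><..<\<epsilon>} \<subseteq> \<Sigma> \<and>
             \<gamma> (0::real) = p \<and> (\<gamma> has_vector_derivative v) (at 0)}"

definition smooth_along :: "'a::euclidean_space set \<Rightarrow> ('a \<Rightarrow> 'b::real_normed_vector) \<Rightarrow> bool" where
  "smooth_along \<Sigma> f \<longleftrightarrow>
     (\<forall>p\<in>\<Sigma>. \<exists>V g. open V \<and> p \<in> V \<and> smooth_on V g \<and> (\<forall>x\<in>\<Sigma> \<inter> V. f x = g x))"

definition tangent_field :: "'a::euclidean_space set \<Rightarrow> 'a set \<Rightarrow> ('a \<Rightarrow> 'a) \<Rightarrow> bool" where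
  "tangent_field \<Sigma> V Y \<longleftrightarrow> smooth_along V Y \<and> (\<forall>x\<in>V. Y x \<in> tangent_space \<Sigma> x)"

text \<open>
  \<open>flat_deriv \<Sigma> f p v\<close> is the derivative at \<open>p\<close> of a function \<open>f\<close> along \<open>\<Sigma>\<close> in the direction \<open>v\<close> tangent
  to \<open>\<Sigma>\<close>; for vector-valued \<open>f\<close> it is the standard flat connection.  A derivative of \<open>f\<close> within
  \<open>\<Sigma>\<close> is not unique as a linear map on the ambient space, but its values on tangent vectors are
  (they are the derivatives of \<open>f\<close> along curves in \<open>\<Sigma>\<close>).
\<close>

definition flat_deriv ::
    "'a::euclidean_space set \<Rightarrow> ('a \<Rightarrow> 'b::real_normed_vector) \<Rightarrow> 'a \<Rightarrow> 'a \<Rightarrow> 'b" where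
  "flat_deriv \<Sigma> f p v = frechet_derivative f (at p within \<Sigma>) v"

definition transversal :: "'a::euclidean_space set \<Rightarrow> ('a \<Rightarrow> 'a) \<Rightarrow> bool" where
  "transversal \<Sigma> T \<longleftrightarrow> smooth_along \<Sigma> T \<and> (\<forall>p\<in>\<Sigma>. T p \<notin> tangent_space \<Sigma> p)"

text \<open>A co-orientation of \<open>\<Sigma>\<close> is represented by a transversal \<open>\<nu>\<close>; it orients the normal line at \<open>p\<close>,
  i.e. the quotient of the ambient space by the tangent space.\<close>

definition co_oriented :: "'a::euclidean_space set \<Rightarrow> ('a \<Rightarrow> 'a) \<Rightarrow> ('a \<Rightarrow> 'a) \<Rightarrow> bool" where
  "co_oriented \<Sigma> \<nu> T \<longleftrightarrow> (\<forall>p\<in>\<Sigma>. \<exists>c>0. T p - c *\<^sub>R \<nu> p \<in> tangent_space \<Sigma> p)"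

text \<open>The coefficient of \<open>T p\<close> in the splitting of \<open>w\<close> into a tangent vector and a multiple of \<open>T p\<close>.\<close>

definition transversal_coeff :: "'a::euclidean_space set \<Rightarrow> ('a \<Rightarrow> 'a) \<Rightarrow> 'a \<Rightarrow> 'a \<Rightarrow> real" where
  "transversal_coeff \<Sigma> T p w = (THE c. w - c *\<^sub>R T p \<in> tangent_space \<Sigma> p)"

definition induced_connection ::
    "'a::euclidean_space set \<Rightarrow> ('a \<Rightarrow> 'a) \<Rightarrow> 'a \<Rightarrow> 'a \<Rightarrow> ('a \<Rightarrow> 'a) \<Rightarrow> 'a" where
  "induced_connection \<Sigma> T p u Y =
     flat_deriv \<Sigma> Y p u - transversal_coeff \<Sigma> T p (flat_deriv \<Sigma> Y p u) *\<^sub>R T p"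

text \<open>The tensor \<open>h\<close> at \<open>p\<close>: the value on tangent vectors \<open>u, v\<close> is the transversal coefficient of the
  derivative along \<open>u\<close> of any local tangent field with value \<open>v\<close> at \<open>p\<close>.\<close>

definition second_fundamental_form ::
    "'a::euclidean_space set \<Rightarrow> ('a \<Rightarrow> 'a) \<Rightarrow> 'a \<Rightarrow> 'a \<Rightarrow> 'a \<Rightarrow> real" where
  "second_fundamental_form \<Sigma> T p u v =
     (THE c. \<forall>V Y. openin (top_of_set \<Sigma>) V \<longrightarrow> p \<in> V \<longrightarrow> tangent_field \<Sigma> V Y \<longrightarrow> Y p = v \<longrightarrow>
        transversal_coeff \<Sigma> T p (flat_deriv \<Sigma> Y p u) = c)"

text \<open>Nondegeneracy of \<open>\<Sigma>\<close>; the condition does not depend on the transversal \<open>T\<close> used to express it.\<close>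

definition nondegenerate :: "'a::euclidean_space set \<Rightarrow> ('a \<Rightarrow> 'a) \<Rightarrow> bool" where
  "nondegenerate \<Sigma> T \<longleftrightarrow>
     (\<forall>p\<in>\<Sigma>. \<forall>u\<in>tangent_space \<Sigma> p.
        (\<forall>v\<in>tangent_space \<Sigma> p. second_fundamental_form \<Sigma> T p u v = 0) \<longrightarrow> u = 0)"

section \<open>Densities and the equiaffine normal\<close>

text \<open>A density is represented by its values at a point on \<open>n\<close>-tuples of tangent vectors.\<close>

definition Psi :: "('m option \<Rightarrow> real ^ ('m::finite option)) \<Rightarrow> real" where
  "Psi v = det (\<chi> k. v k)"

definition interior_density ::
    "(real ^ ('m::finite option) \<Rightarrow> real ^ ('m option)) \<Rightarrow>
     real ^ ('m option) \<Rightarrow> ('m \<Rightarrow> real ^ ('m option)) \<Rightarrow> real" where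
  "interior_density T p Y = \<bar>Psi (case_option (T p) Y)\<bar>"

definition metric_density ::
    "('a \<Rightarrow> 'a \<Rightarrow> 'a \<Rightarrow> real) \<Rightarrow> 'a \<Rightarrow> ('m::finite \<Rightarrow> 'a) \<Rightarrow> real" where
  "metric_density h p Y = sqrt \<bar>det (\<chi> i j. h p (Y i) (Y j))\<bar>"

text \<open>
  In a local frame \<open>Y\<close> with \<open>\<nabla>\<^sub>u Y\<^sub>i = A\<^sub>i\<^sub>j Y\<^sub>j\<close> the covariant derivative of a density is
  \<open>(\<nabla>\<^sub>u \<rho>)(Y) = u(\<rho>(Y)) - tr(A) \<rho>(Y)\<close>; for the absolute value of a volume form this is the Leibniz rule.
\<close>

definition parallel_density ::
    "'a::euclidean_space set \<Rightarrow> ('a \<Rightarrow> 'a) \<Rightarrow> ('a \<Rightarrow> ('m::finite \<Rightarrow> 'a) \<Rightarrow> real) \<Rightarrow> bool" where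
  "parallel_density \<Sigma> T \<rho> \<longleftrightarrow>
     (\<forall>V (Y :: 'm \<Rightarrow> 'a \<Rightarrow> 'a).
        openin (top_of_set \<Sigma>) V \<longrightarrow>
        (\<forall>i. tangent_field \<Sigma> V (Y i)) \<longrightarrow>
        (\<forall>x\<in>V. inj (\<lambda>i. Y i x) \<and> independent (range (\<lambda>i. Y i x))) \<longrightarrow>
        (\<forall>p\<in>V. \<forall>u\<in>tangent_space \<Sigma> p. \<forall>A :: real ^ 'm ^ 'm.
           (\<forall>i. induced_connection \<Sigma> T p u (Y i) = (\<Sum>j\<in>UNIV. (A $ i $ j) *\<^sub>R Y j p)) \<longrightarrow>
           flat_deriv \<Sigma> (\<lambda>x. \<rho> x (\<lambda>i. Y i x)) p u - trace A * \<rho> p (\<lambda>i. Y i p) = 0))"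

definition equiaffine_transversal ::
    "(real ^ ('m::finite option)) set \<Rightarrow> (real ^ ('m option) \<Rightarrow> real ^ ('m option)) \<Rightarrow>
     (real ^ ('m option) \<Rightarrow> real ^ ('m option)) \<Rightarrow> bool" where
  "equiaffine_transversal \<Sigma> \<nu> W \<longleftrightarrow>
     transversal \<Sigma> W \<and> co_oriented \<Sigma> \<nu> W \<and>
     (\<forall>p\<in>\<Sigma>. \<forall>Y :: 'm \<Rightarrow> real ^ ('m option). (\<forall>i. Y i \<in> tangent_space \<Sigma> p) \<longrightarrow>
        interior_density W p Y = metric_density (second_fundamental_form \<Sigma> W) p Y) \<and>
     parallel_density \<Sigma> W (interior_density W)"

text \<open>\<open>W\<close> is the equiaffine normal of the nondegenerate hypersurface \<open>\<Sigma>\<close> co-oriented by \<open>\<nu>\<close>.  Only the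
  values of \<open>W\<close> on \<open>\<Sigma>\<close> matter.\<close>

definition is_equiaffine_normal ::
    "(real ^ ('m::finite option)) set \<Rightarrow> (real ^ ('m option) \<Rightarrow> real ^ ('m option)) \<Rightarrow>
     (real ^ ('m option) \<Rightarrow> real ^ ('m option)) \<Rightarrow> bool" where
  "is_equiaffine_normal \<Sigma> \<nu> W \<longleftrightarrow>
     hypersurface \<Sigma> \<and> transversal \<Sigma> \<nu> \<and> nondegenerate \<Sigma> \<nu> \<and>
     equiaffine_transversal \<Sigma> \<nu> W \<and>
     (\<forall>W'. equiaffine_transversal \<Sigma> \<nu> W' \<longrightarrow> (\<forall>p\<in>\<Sigma>. W' p = W p))"

section \<open>Tensors associated with a function\<close>

definition partial_deriv :: "'k::finite \<Rightarrow> (real ^ 'k \<Rightarrow> real) \<Rightarrow> real ^ 'k \<Rightarrow> real" where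
  "partial_deriv i f x = frechet_derivative f (at x) (axis i 1)"

definition grad :: "(real ^ 'k::finite \<Rightarrow> real) \<Rightarrow> real ^ 'k \<Rightarrow> real ^ 'k" where
  "grad F x = (\<chi> i. partial_deriv i F x)"

definition hess :: "(real ^ 'k::finite \<Rightarrow> real) \<Rightarrow> real ^ 'k \<Rightarrow> real ^ 'k ^ 'k" where
  "hess F x = (\<chi> i j. partial_deriv i (partial_deriv j F) x)"

definition hess_det :: "(real ^ 'k::finite \<Rightarrow> real) \<Rightarrow> real ^ 'k \<Rightarrow> real" where
  "hess_det F x = det (hess F x)"

text \<open>The entry \<open>(i, j)\<close> of the adjugate is the cofactor \<open>(j, i)\<close>, written as the determinant of the matrix
  whose column \<open>i\<close> is replaced by the \<open>j\<close>-th standard basis vector.\<close>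

definition adjugate :: "real ^ 'k ^ 'k \<Rightarrow> real ^ 'k::finite ^ 'k" where
  "adjugate A = (\<chi> i j. det (\<chi> k l. if l = i then (if k = j then 1 else 0) else A $ k $ l))"

lemma adjugate_mult: "adjugate A ** A = mat (det A)"
proof -
  have "(adjugate A ** A) $ i $ k = mat (det A) $ i $ k" for i k
  proof -
    define B where "B = transpose A"
    have adj: "adjugate A $ i $ j = det (\<chi> l. if l = i then axis j 1 else row l B)" for j
      unfolding adjugate_def vec_lambda_beta
      by (subst det_transpose[symmetric], rule arg_cong[of _ _ det])
        (auto simp: vec_eq_iff transpose_def row_def B_def axis_def)
    have "(adjugate A ** A) $ i $ k =
        (\<Sum>j\<in>UNIV. A $ j $ k * det (\<chi> l. if l = i then axis j 1 else row l B))"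
      by (simp add: matrix_matrix_mult_def adj mult.commute)
    also have "\<dots> = (\<Sum>j\<in>UNIV. det (\<chi> l. if l = i then (A $ j $ k) *s axis j 1 else row l B))"
      by (simp add: det_row_mul)
    also have "\<dots> = det (\<chi> l. if l = i then (\<Sum>j\<in>UNIV. (A $ j $ k) *s axis j 1) else row l B)"
      by (subst det_linear_row_sum) auto
    also have "(\<Sum>j\<in>UNIV. (A $ j $ k) *s axis j 1) = row k B"
      by (simp add: vec_eq_iff row_def B_def transpose_def axis_def if_distrib cong: if_cong)
    also have "det (\<chi> l. if l = i then row k B else row l B) = mat (det A) $ i $ k"
    proof (cases "i = k")
      case True
      have "(\<chi> l. if l = i then row k B else row l B) = B"
        using True by (auto simp: vec_eq_iff row_def)
      then show ?thesis using True by (simp add: mat_def B_def)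
    next
      case False
      have "det (\<chi> l. if l = i then row k B else row l B) = 0"
        by (rule det_identical_rows[OF False]) (use False in \<open>auto simp: row_def vec_eq_iff\<close>)
      then show ?thesis using False by (simp add: mat_def)
    qed
    finally show ?thesis .
  qed
  then show ?thesis by (simp add: vec_eq_iff)
qed

definition N_field :: "(real ^ 'k::finite \<Rightarrow> real) \<Rightarrow> real ^ 'k \<Rightarrow> real ^ 'k" where
  "N_field F x = (\<chi> i. \<Sum>p\<in>UNIV. adjugate (hess F x) $ i $ p * grad F x $ p)"

definition U_fun :: "(real ^ 'k::finite \<Rightarrow> real) \<Rightarrow> real ^ 'k \<Rightarrow> real" where
  "U_fun F x = (\<Sum>i\<in>UNIV. \<Sum>j\<in>UNIV. adjugate (hess F x) $ i $ j * grad F x $ i * grad F x $ j)"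

definition Pi_lower :: "(real ^ 'k::finite \<Rightarrow> real) \<Rightarrow> real ^ 'k \<Rightarrow> real ^ 'k ^ 'k" where
  "Pi_lower F x =
     (\<chi> i j. hess F x $ i $ j - inverse (U_fun F x) * hess_det F x * grad F x $ i * grad F x $ j)"

definition m_tensor ::
    "(real ^ 'k::finite \<Rightarrow> real) \<Rightarrow> (real ^ 'k \<Rightarrow> real) \<Rightarrow> real ^ 'k \<Rightarrow> real ^ 'k ^ 'k" where
  "m_tensor F q x =
     (\<chi> i j. Pi_lower F x $ i $ j + q x * inverse (U_fun F x) * grad F x $ i * grad F x $ j)"

definition Pi_upper ::
    "(real ^ 'k::finite \<Rightarrow> real) \<Rightarrow> (real ^ 'k \<Rightarrow> real) \<Rightarrow> real ^ 'k \<Rightarrow> real ^ 'k ^ 'k" where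
  "Pi_upper F q x =
     (\<chi> i j. matrix_inv (m_tensor F q x) $ i $ j -
             inverse (q x) * inverse (U_fun F x) * N_field F x $ i * N_field F x $ j)"

definition k_tensor ::
    "(real ^ ('m::finite option) \<Rightarrow> real) \<Rightarrow> (real ^ ('m option) \<Rightarrow> real) \<Rightarrow>
     real ^ ('m option) \<Rightarrow> real ^ ('m option) ^ ('m option)" where
  "k_tensor F q x =
     (\<chi> i j. \<bar>U_fun F x\<bar> powr (1 / (real CARD('m) + 2)) * Pi_upper F q x $ i $ j)"

definition mu :: "(real ^ ('m::finite option) \<Rightarrow> real) \<Rightarrow> real ^ ('m option) \<Rightarrow> real ^ ('m option)" where
  "mu F x = (\<chi> i. inverse (real CARD('m) + 2) * partial_deriv i (\<lambda>y. ln \<bar>U_fun F y\<bar>) x)"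

definition level_set :: "('a \<Rightarrow> 'b) \<Rightarrow> 'a set \<Rightarrow> 'b \<Rightarrow> 'a set" where
  "level_set F \<Omega> r = {x \<in> \<Omega>. F x = r}"

end

theory Submission
  imports Defs
begin

text \<open>
  Write \<open>g\<close> and \<open>H\<close> for the gradient and the Hessian of \<open>F\<close> and \<open>n\<close> for the dimension of the level set \<open>\<Sigma>\<close>,
  whose tangent space is the orthogonal complement of \<open>g\<close>.  Differentiating \<open>g \<bullet> Y = 0\<close> shows that a transversal \<open>T\<close> has
  \<open>h(u, v) = - u\<^sup>T H v / (g \<bullet> T)\<close>.  Since \<open>det(N, Y)\<^sup>2 = U(F) det(Y\<^sub>i\<^sup>T H Y\<^sub>j)\<close> for tangent \<open>Y\<^sub>i\<close>, the two densities agree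
  exactly when \<open>\<bar>g \<bullet> T\<bar> ^ (n + 2) = \<bar>U(F)\<bar>\<close>, so with the given co-orientation
  \<open>g \<bullet> T = - \<bar>U(F)\<bar> powr (1 / (n + 2))\<close>.  The density is parallel exactly when
  \<open>g \<bullet> D\<^sub>u T = 0\<close> for tangent \<open>u\<close>; differentiating the formula for \<open>g \<bullet> T\<close>, this says
  \<open>u\<^sup>T H T = (g \<bullet> T) \<mu>(u)\<close>.  As \<open>H N\<close> is a multiple of \<open>g\<close>, and \<open>\<Pi>\<close> with upper indices inverts \<open>H\<close> on tangent vectors,
  \<open>W\<close> has both properties; as \<open>H\<close> is nondegenerate on tangent vectors, they determine the transversal.
\<close>

section \<open>Calculus of smooth functions\<close>

text \<open>The Hessian H may be singular, so neither its inverse nor division by its determinant is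
  available. The tensor m repairs this: it is H plus a multiple of g g^T, so it acts as H on tangent
  vectors, while its determinant is the nonvanishing function q. The exponent n + 2 counts powers of
  a = g \<bullet> T: the square of the density det(T, Y) scales as a^2, the determinant of h as
  a^(-n). A field given only along \<Sigma> has a derivative that is determined only on velocities
  of curves in \<Sigma>. Hence every vector annihilated by dF must be realized by a smooth curve,
  and this is where the inverse function theorem enters. Existence and uniqueness rest on one
  identity, g \<bullet> D_u T = u^T H (W - T), valid for every transversal T for which g \<bullet> T
  has the prescribed value.\<close>

lemma Ck_on_cong:
  assumes "open S" "\<And>x. x \<in> S \<Longrightarrow> f x = g x" "Ck_on k S f"
  shows "Ck_on k S g"
  using assms(2,3)
proof (induction k arbitrary: f g)
  case 0
  then show ?case by (auto cong: continuous_on_cong)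
next
  case (Suc k)
  have g: "(g has_derivative frechet_derivative f (at x)) (at x)" if "x \<in> S" for x
    using has_derivative_transform_within_open[OF _ \<open>open S\<close> that Suc.prems(1)] Suc.prems(2) that
    by (simp add: frechet_derivative_works)
  have "Ck_on k S (\<lambda>x. frechet_derivative g (at x) v)" for v
    by (rule Suc.IH[of "\<lambda>x. frechet_derivative f (at x) v"])
      (use Suc.prems(2) frechet_derivative_at[OF g] in auto)
  moreover have "g differentiable (at x)" if "x \<in> S" for x
    using g[OF that] by (auto simp: differentiable_def)
  ultimately show ?case by simp
qed

text \<open>Uniqueness of the derivative allows any explicit formula in place of
  \<open>frechet_derivative\<close>; this is the induction step of the closure results that
  differentiate by a rule.\<close>

lemma Ck_on_SucI:
  assumes "open S" "\<And>x. x \<in> S \<Longrightarrow> (f has_derivative f' x) (at x)"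
    and "\<And>v. Ck_on k S (\<lambda>x. f' x v)"
  shows "Ck_on (Suc k) S f"
proof -
  have "Ck_on k S (\<lambda>x. frechet_derivative f (at x) v)" for v
    by (rule Ck_on_cong[OF assms(1) _ assms(3)]) (simp add: frechet_derivative_at[OF assms(2), symmetric])
  then show ?thesis using assms(2) by (auto simp: differentiable_def)
qed

lemma Ck_on_Suc_has_derivative:
  "Ck_on (Suc k) S f \<Longrightarrow> x \<in> S \<Longrightarrow> (f has_derivative frechet_derivative f (at x)) (at x)"
  by (simp add: frechet_derivative_works)

lemma Ck_on_SucD: "Ck_on (Suc k) S f \<Longrightarrow> Ck_on k S f"
proof (induction k arbitrary: f)
  case 0
  then show ?case
    by (auto intro!: continuous_at_imp_continuous_on differentiable_imp_continuous_within)
next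
  case (Suc k)
  have "Ck_on k S (\<lambda>x. frechet_derivative f (at x) v)" for v
    by (rule Suc.IH) (use Suc.prems in auto)
  then show ?case using Suc.prems by auto
qed

lemma Ck_on_subset: "Ck_on k S f \<Longrightarrow> T \<subseteq> S \<Longrightarrow> Ck_on k T f"
  by (induction k arbitrary: f) (auto intro: continuous_on_subset)

lemma Ck_on_const: "open S \<Longrightarrow> Ck_on k S (\<lambda>x. c)"
proof (induction k arbitrary: c)
  case (Suc k)
  then show ?case by (intro Ck_on_SucI[where f' = "\<lambda>x h. 0"]) auto
qed simp

lemma Ck_on_bounded_linear:
  assumes "bounded_linear L" "open S"
  shows "Ck_on k S f \<Longrightarrow> Ck_on k S (\<lambda>x. L (f x))"
proof (induction k arbitrary: f)
  case 0
  then show ?case using bounded_linear.continuous_on[OF assms(1)] by auto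
next
  case (Suc k)
  show ?case
    by (rule Ck_on_SucI[OF assms(2), where f' = "\<lambda>x v. L (frechet_derivative f (at x) v)"])
      (use Suc in \<open>auto intro: bounded_linear.has_derivative[OF assms(1)] simp: frechet_derivative_works\<close>)
qed

lemma Ck_on_add:
  assumes "open S"
  shows "Ck_on k S f \<Longrightarrow> Ck_on k S g \<Longrightarrow> Ck_on k S (\<lambda>x. f x + g x)"
proof (induction k arbitrary: f g)
  case 0
  then show ?case by (auto intro: continuous_intros)
next
  case (Suc k)
  show ?case
    by (rule Ck_on_SucI[OF assms(1),
          where f' = "\<lambda>x v. frechet_derivative f (at x) v + frechet_derivative g (at x) v"])
      (use Suc in \<open>auto intro!: has_derivative_add simp: frechet_derivative_works\<close>)
qed

text \<open>One product rule serves products, scalar multiples and inner products alike.\<close>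

lemma Ck_on_bilinear:
  assumes "bounded_bilinear b" "open S"
  shows "Ck_on k S f \<Longrightarrow> Ck_on k S g \<Longrightarrow> Ck_on k S (\<lambda>x. b (f x) (g x))"
proof (induction k arbitrary: f g)
  case 0
  then show ?case by (auto intro: bounded_bilinear.continuous_on[OF assms(1)])
next
  case (Suc k)
  note d = Suc.prems(1)[THEN Ck_on_SucD] Suc.prems(2)[THEN Ck_on_SucD]
  show ?case
  proof (rule Ck_on_SucI[OF assms(2)])
    fix x assume "x \<in> S"
    then show "((\<lambda>x. b (f x) (g x)) has_derivative
        (\<lambda>v. b (f x) (frechet_derivative g (at x) v) + b (frechet_derivative f (at x) v) (g x))) (at x)"
      by (intro bounded_bilinear.FDERIV[OF assms(1)] Ck_on_Suc_has_derivative[OF Suc.prems(1)]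
          Ck_on_Suc_has_derivative[OF Suc.prems(2)])
  next
    fix v
    show "Ck_on k S (\<lambda>x. b (f x) (frechet_derivative g (at x) v) + b (frechet_derivative f (at x) v) (g x))"
      by (intro Ck_on_add assms Suc.IH d) (use Suc.prems in auto)
  qed
qed

lemma Ck_on_sum:
  "open S \<Longrightarrow> (\<And>i. i \<in> I \<Longrightarrow> Ck_on k S (f i)) \<Longrightarrow> Ck_on k S (\<lambda>x. \<Sum>i\<in>I. f i x)"
  by (induction I rule: infinite_finite_induct) (auto intro: Ck_on_const Ck_on_add)

lemma Ck_on_compose:
  fixes f :: "'a::euclidean_space \<Rightarrow> 'b::real_normed_vector"
  assumes "open S" "open T" and gT: "g ` S \<subseteq> T"
  shows "Ck_on k T f \<Longrightarrow> Ck_on k S g \<Longrightarrow> Ck_on k S (\<lambda>x. f (g x))"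
proof (induction k arbitrary: f)
  case 0
  then show ?case using gT by (auto intro: continuous_on_compose2)
next
  case (Suc k)
  note f = Ck_on_Suc_has_derivative[OF Suc.prems(1)] and g = Ck_on_Suc_has_derivative[OF Suc.prems(2)]
  show ?case
  proof (rule Ck_on_SucI[OF assms(1)])
    fix x assume x: "x \<in> S"
    \<comment> \<open>The chain rule applies a linear map depending on x to a vector depending on x,
      while \<open>Ck_on\<close> controls derivatives in fixed directions only. Expanding in
      \<open>Basis\<close> separates the two into products covered by the induction
      hypothesis.\<close>
    have lin: "frechet_derivative f (at (g x)) w
        = (\<Sum>b\<in>Basis. (w \<bullet> b) *\<^sub>R frechet_derivative f (at (g x)) b)" for w
    proof -
      have "linear (frechet_derivative f (at (g x)))"
        using f[of "g x"] gT x by (auto simp: has_derivative_linear)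
      from linear_sum[OF this, of "\<lambda>b. (w \<bullet> b) *\<^sub>R b" Basis] linear_scale[OF this]
      show ?thesis by (simp add: euclidean_representation)
    qed
    have "((\<lambda>x. f (g x)) has_derivative
        (\<lambda>v. frechet_derivative f (at (g x)) (frechet_derivative g (at x) v))) (at x)"
      using has_derivative_compose[OF g[OF x] f] x gT by blast
    then show "((\<lambda>x. f (g x)) has_derivative
        (\<lambda>v. \<Sum>b\<in>Basis. (frechet_derivative g (at x) v \<bullet> b) *\<^sub>R frechet_derivative f (at (g x)) b)) (at x)"
      by (rule has_derivative_eq_rhs) (rule ext, rule lin)
  next
    fix v
    show "Ck_on k S (\<lambda>x. \<Sum>b\<in>Basis. (frechet_derivative g (at x) v \<bullet> b) *\<^sub>R frechet_derivative f (at (g x)) b)"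
    proof (intro Ck_on_sum Ck_on_bilinear[OF bounded_bilinear_scaleR] assms)
      fix b
      show "Ck_on k S (\<lambda>x. frechet_derivative f (at (g x)) b)"
        by (rule Suc.IH) (use Suc.prems(1) Ck_on_SucD[OF Suc.prems(2)] in auto)
      show "Ck_on k S (\<lambda>x. frechet_derivative g (at x) v \<bullet> b)"
        by (rule Ck_on_bounded_linear[OF bounded_linear_inner_left assms(1)]) (use Suc.prems(2) in auto)
    qed
  qed
qed

lemma Ck_on_inverse_real: "Ck_on k (- {0}) (inverse :: real \<Rightarrow> real)"
proof (induction k)
  case (Suc k)
  show ?case
  proof (rule Ck_on_SucI)
    show "(inverse has_derivative (\<lambda>h::real. - (inverse x * h * inverse x))) (at x)" if "x \<in> - {0}" for x
      using has_derivative_inverse' that by auto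
    show "Ck_on k (- {0}) (\<lambda>x::real. - (inverse x * v * inverse x))" for v
      by (intro Ck_on_bounded_linear[OF bounded_linear_minus[OF bounded_linear_ident]]
          Ck_on_bilinear[OF bounded_bilinear_mult] Suc Ck_on_const) auto
  qed auto
qed (auto intro: continuous_intros)

lemma Ck_on_powr_real: "Ck_on k {0<..} (\<lambda>x::real. x powr c)"
proof (induction k arbitrary: c)
  case (Suc k)
  show ?case
  proof (rule Ck_on_SucI)
    show "((\<lambda>x. x powr c) has_derivative (\<lambda>h. c * x powr (c - 1) * h)) (at x)" if "x \<in> {0<..}" for x
      using has_real_derivative_powr[of x c] that by (auto simp: has_field_derivative_def)
    show "Ck_on k {0<..} (\<lambda>x::real. c * x powr (c - 1) * v)" for v
      by (intro Ck_on_bilinear[OF bounded_bilinear_mult] Suc Ck_on_const) auto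
  qed auto
qed (auto intro!: continuous_intros)

section \<open>Closure properties of smooth functions\<close>

lemma smooth_on_cong:
  "open S \<Longrightarrow> (\<And>x. x \<in> S \<Longrightarrow> f x = g x) \<Longrightarrow> smooth_on S f \<Longrightarrow> smooth_on S g"
  unfolding smooth_on_def using Ck_on_cong by blast

lemma smooth_on_subset: "smooth_on S f \<Longrightarrow> T \<subseteq> S \<Longrightarrow> smooth_on T f"
  unfolding smooth_on_def using Ck_on_subset by blast

lemma smooth_on_has_derivative:
  "smooth_on S f \<Longrightarrow> x \<in> S \<Longrightarrow> (f has_derivative frechet_derivative f (at x)) (at x)"
  unfolding smooth_on_def using Ck_on_Suc_has_derivative by blast

lemma smooth_on_continuous_on: "smooth_on S f \<Longrightarrow> continuous_on S f"
  unfolding smooth_on_def by (metis Ck_on.simps(1))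

lemma smooth_on_frechet_derivative:
  "smooth_on S f \<Longrightarrow> smooth_on S (\<lambda>x. frechet_derivative f (at x) v)"
  unfolding smooth_on_def by (metis Ck_on.simps(2))

lemma smooth_on_const: "open S \<Longrightarrow> smooth_on S (\<lambda>x. c)"
  unfolding smooth_on_def by (simp add: Ck_on_const)

lemma smooth_on_bounded_linear:
  "bounded_linear L \<Longrightarrow> open S \<Longrightarrow> smooth_on S f \<Longrightarrow> smooth_on S (\<lambda>x. L (f x))"
  unfolding smooth_on_def by (simp add: Ck_on_bounded_linear)

lemma smooth_on_add:
  "open S \<Longrightarrow> smooth_on S f \<Longrightarrow> smooth_on S g \<Longrightarrow> smooth_on S (\<lambda>x. f x + g x)"
  unfolding smooth_on_def by (simp add: Ck_on_add)

lemma smooth_on_minus: "open S \<Longrightarrow> smooth_on S f \<Longrightarrow> smooth_on S (\<lambda>x. - f x)"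
  using smooth_on_bounded_linear[OF bounded_linear_minus[OF bounded_linear_ident]] by blast

lemma smooth_on_diff:
  "open S \<Longrightarrow> smooth_on S f \<Longrightarrow> smooth_on S g \<Longrightarrow> smooth_on S (\<lambda>x. f x - g x)"
  using smooth_on_add[OF _ _ smooth_on_minus, of S f g] by simp

lemma smooth_on_bilinear:
  "bounded_bilinear b \<Longrightarrow> open S \<Longrightarrow> smooth_on S f \<Longrightarrow> smooth_on S g \<Longrightarrow> smooth_on S (\<lambda>x. b (f x) (g x))"
  unfolding smooth_on_def by (simp add: Ck_on_bilinear)

lemmas smooth_on_mult = smooth_on_bilinear[OF bounded_bilinear_mult]
  and smooth_on_scaleR = smooth_on_bilinear[OF bounded_bilinear_scaleR]
  and smooth_on_inner = smooth_on_bilinear[OF bounded_bilinear_inner]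

lemma smooth_on_sum:
  "open S \<Longrightarrow> (\<And>i. i \<in> I \<Longrightarrow> smooth_on S (f i)) \<Longrightarrow> smooth_on S (\<lambda>x. \<Sum>i\<in>I. f i x)"
  unfolding smooth_on_def by (simp add: Ck_on_sum)

lemma smooth_on_prod:
  fixes f :: "'i \<Rightarrow> 'a::euclidean_space \<Rightarrow> real"
  shows "open S \<Longrightarrow> (\<And>i. i \<in> I \<Longrightarrow> smooth_on S (f i)) \<Longrightarrow> smooth_on S (\<lambda>x. \<Prod>i\<in>I. f i x)"
  by (induction I rule: infinite_finite_induct) (auto intro: smooth_on_const smooth_on_mult)

lemma smooth_on_inverse:
  fixes f :: "'a::euclidean_space \<Rightarrow> real"
  shows "open S \<Longrightarrow> smooth_on S f \<Longrightarrow> (\<And>x. x \<in> S \<Longrightarrow> f x \<noteq> 0) \<Longrightarrow> smooth_on S (\<lambda>x. inverse (f x))"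
  unfolding smooth_on_def
  by (intro allI Ck_on_compose[of S "- {0}" f _ inverse] Ck_on_inverse_real) auto

text \<open>The kink of the absolute value is avoided by |y|^c = (y^2)^(c/2), a power of a positive
  smooth function.\<close>

lemma smooth_on_abs_powr:
  fixes f :: "'a::euclidean_space \<Rightarrow> real"
  assumes "open S" "smooth_on S f" "\<And>x. x \<in> S \<Longrightarrow> f x \<noteq> 0"
  shows "smooth_on S (\<lambda>x. \<bar>f x\<bar> powr c)"
proof (rule smooth_on_cong[OF assms(1)])
  have pos: "0 < f x * f x" if "x \<in> S" for x
    using not_real_square_gt_zero assms(3)[OF that] by blast
  show "(f x * f x) powr (c / 2) = \<bar>f x\<bar> powr c" for x
  proof (cases "f x = 0")
    case False
    then have "(\<bar>f x\<bar> powr 2) powr (c / 2) = \<bar>f x\<bar> powr c" by (subst powr_powr) simp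
    then show ?thesis using False by (simp add: power2_eq_square)
  qed simp
  show "smooth_on S (\<lambda>x. (f x * f x) powr (c / 2))"
    unfolding smooth_on_def
    by (intro allI Ck_on_compose[of S "{0<..}" "\<lambda>x. f x * f x" _ "\<lambda>x. x powr (c / 2)"] Ck_on_powr_real assms
        Ck_on_bilinear[OF bounded_bilinear_mult])
      (use assms(2) pos in \<open>auto simp: smooth_on_def\<close>)
qed

text \<open>The derivative f' / f is smooth by the closure rules, which gives one order more than is
  asked for, so no induction takes place. Near a nonzero value, ln |y| is differentiated as half of
  ln (y^2).\<close>

lemma smooth_on_ln_abs:
  fixes f :: "'a::euclidean_space \<Rightarrow> real"
  assumes "open S" "smooth_on S f" "\<And>x. x \<in> S \<Longrightarrow> f x \<noteq> 0"
  shows "smooth_on S (\<lambda>x. ln \<bar>f x\<bar>)"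
  unfolding smooth_on_def
proof
  fix k show "Ck_on k S (\<lambda>x. ln \<bar>f x\<bar>)"
  proof (rule Ck_on_SucD, rule Ck_on_SucI[OF assms(1)])
    fix x assume x: "x \<in> S"
    show "((\<lambda>x. ln \<bar>f x\<bar>) has_derivative (\<lambda>v. inverse (f x) * frechet_derivative f (at x) v)) (at x)"
    proof (rule has_derivative_compose[OF smooth_on_has_derivative[OF assms(2) x]])
      have pos: "0 < f x * f x" using not_real_square_gt_zero assms(3)[OF x] by blast
      have "((\<lambda>y::real. ln \<bar>y\<bar>) has_real_derivative inverse (f x)) (at (f x))"
      proof (rule has_field_derivative_transform_within[OF _ zero_less_one])
        show "((\<lambda>y. ln (y * y) / 2) has_real_derivative inverse (f x)) (at (f x))"
          by (rule derivative_eq_intros refl pos)+ (use assms(3)[OF x] in \<open>simp_all add: field_simps\<close>)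
        show "ln (y * y) / 2 = ln \<bar>y\<bar>" for y :: real
          using ln_mult[of "\<bar>y\<bar>" "\<bar>y\<bar>"] by (cases "y = 0") auto
      qed simp
      then show "((\<lambda>y. ln \<bar>y\<bar>) has_derivative (*) (inverse (f x))) (at (f x))"
        by (simp add: has_field_derivative_def)
    qed
  next
    fix v
    have "smooth_on S (\<lambda>x. inverse (f x) * frechet_derivative f (at x) v)"
      by (intro smooth_on_mult smooth_on_inverse smooth_on_frechet_derivative assms)
    then show "Ck_on k S (\<lambda>x. inverse (f x) * frechet_derivative f (at x) v)"
      by (simp add: smooth_on_def)
  qed
qed

lemma smooth_on_vec:
  assumes "open S" "\<And>i. smooth_on S (\<lambda>x. f x i)"
  shows "smooth_on S (\<lambda>x. (\<chi> i. f x i) :: real ^ 'k::finite)"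
proof (rule smooth_on_cong[OF assms(1)])
  show "(\<Sum>i\<in>UNIV. f x i *\<^sub>R axis i 1) = (\<chi> i. f x i)" for x
    by (simp add: vec_eq_iff axis_def if_distrib cong: if_cong)
  show "smooth_on S (\<lambda>x. \<Sum>i\<in>UNIV. f x i *\<^sub>R (axis i 1 :: real ^ 'k))"
    by (intro smooth_on_sum smooth_on_scaleR smooth_on_const assms)
qed

lemma smooth_on_nth: "open S \<Longrightarrow> smooth_on S f \<Longrightarrow> smooth_on S (\<lambda>x. (f x :: 'b::euclidean_space ^ 'k::finite) $ i)"
  by (rule smooth_on_bounded_linear[OF bounded_linear_vec_nth])

lemma smooth_on_det:
  fixes A :: "'a::euclidean_space \<Rightarrow> real ^ 'k::finite ^ 'k"
  assumes "open S" "\<And>i j. smooth_on S (\<lambda>x. A x $ i $ j)"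
  shows "smooth_on S (\<lambda>x. det (A x))"
  unfolding det_def
  by (intro smooth_on_sum smooth_on_mult smooth_on_prod smooth_on_const assms)

text \<open>Bootstrapping: if the curve is of class k, so is its velocity
  \<open>G (\<gamma> t)\<close>, hence the curve is of class k + 1. Curves built from a merely
  differentiable local inverse turn out smooth in this way.\<close>

lemma smooth_on_integral_curve:
  fixes \<gamma> :: "real \<Rightarrow> 'a::euclidean_space"
  assumes "open I" "open V" "\<gamma> ` I \<subseteq> V" "smooth_on V G"
    and "\<And>t. t \<in> I \<Longrightarrow> (\<gamma> has_vector_derivative G (\<gamma> t)) (at t)"
  shows "smooth_on I \<gamma>"
  unfolding smooth_on_def
proof
  fix k show "Ck_on k I \<gamma>"
  proof (induction k)
    case 0
    show ?case
      using assms(5) by (auto intro!: continuous_at_imp_continuous_on has_vector_derivative_continuous)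
  next
    case (Suc k)
    show ?case
    proof (rule Ck_on_SucI[OF assms(1)])
      show "(\<gamma> has_derivative (\<lambda>h. h *\<^sub>R G (\<gamma> t))) (at t)" if "t \<in> I" for t
        using assms(5)[OF that] by (simp add: has_vector_derivative_def)
      show "Ck_on k I (\<lambda>t. v *\<^sub>R G (\<gamma> t))" for v
        using assms(4)
        by (intro Ck_on_bilinear[OF bounded_bilinear_scaleR] Ck_on_const assms
            Ck_on_compose[of I V \<gamma> k G] Suc) (auto simp: smooth_on_def)
    qed
  qed
qed

text \<open>The second difference \<Delta> over the parallelogram spanned by s a and s b is
  symmetric in a and b. Two applications of the mean value theorem express it as s^2 times a mixed
  derivative at a nearby point, in either order of the directions; continuity of the mixed
  derivatives does the rest.\<close>

lemma frechet_derivative_symmetric: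
  fixes f :: "'a::euclidean_space \<Rightarrow> real"
  assumes "open S" "smooth_on S f" "x \<in> S"
  shows "frechet_derivative (\<lambda>y. frechet_derivative f (at y) a) (at x) b
       = frechet_derivative (\<lambda>y. frechet_derivative f (at y) b) (at x) a"
proof -
  define D where "D a b y = frechet_derivative (\<lambda>y. frechet_derivative f (at y) a) (at y) b" for a b y
  define \<Delta> where "\<Delta> a b s = f (x + s *\<^sub>R a + s *\<^sub>R b) - f (x + s *\<^sub>R a) - f (x + s *\<^sub>R b) + f x" for a b s
  have mean: "\<exists>\<sigma> \<tau>. 0 < \<sigma> \<and> \<sigma> < s \<and> 0 < \<tau> \<and> \<tau> < s \<and> \<Delta> a b s = s * s * D a b (x + \<sigma> *\<^sub>R a + \<tau> *\<^sub>R b)"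
    if s: "0 < s" and inS: "\<And>\<sigma> \<tau>. 0 \<le> \<sigma> \<Longrightarrow> \<sigma> \<le> s \<Longrightarrow> 0 \<le> \<tau> \<Longrightarrow> \<tau> \<le> s \<Longrightarrow> x + \<sigma> *\<^sub>R a + \<tau> *\<^sub>R b \<in> S" for s a b
  proof -
    define \<phi> where "\<phi> t = f (x + t *\<^sub>R a + s *\<^sub>R b) - f (x + t *\<^sub>R a)" for t
    have d: "((\<lambda>t. f (y + t *\<^sub>R v)) has_real_derivative frechet_derivative f (at (y + t *\<^sub>R v)) v) (at t)"
      if "y + t *\<^sub>R v \<in> S" "smooth_on S f" for y v t and f :: "'a \<Rightarrow> real"
    proof -
      have f: "(f has_derivative frechet_derivative f (at (y + t *\<^sub>R v))) (at (y + t *\<^sub>R v))"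
        using smooth_on_has_derivative that by blast
      have "((\<lambda>t. y + t *\<^sub>R v) has_derivative (\<lambda>h. h *\<^sub>R v)) (at t)"
        by (auto intro!: derivative_eq_intros)
      from has_derivative_compose[OF this f] show ?thesis
        using linear_scale[OF has_derivative_linear[OF f]]
        by (simp add: has_field_derivative_def mult_commute_abs)
    qed
    have "\<exists>\<sigma>. 0 < \<sigma> \<and> \<sigma> < s \<and> \<phi> s - \<phi> 0 = (s - 0) * (frechet_derivative f (at (x + \<sigma> *\<^sub>R a + s *\<^sub>R b)) a
        - frechet_derivative f (at (x + \<sigma> *\<^sub>R a)) a)"
    proof (rule MVT2[OF s])
      fix t assume t: "0 \<le> t" "t \<le> s"
      have "x + s *\<^sub>R b + t *\<^sub>R a \<in> S" "x + t *\<^sub>R a \<in> S"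
        using inS[of t s] inS[of t 0] s t by (auto simp: algebra_simps)
      from d[OF this(1) assms(2)] d[OF this(2) assms(2)]
      show "(\<phi> has_real_derivative (frechet_derivative f (at (x + t *\<^sub>R a + s *\<^sub>R b)) a
          - frechet_derivative f (at (x + t *\<^sub>R a)) a)) (at t)"
        unfolding \<phi>_def by (intro DERIV_diff) (auto simp: algebra_simps)
    qed
    then obtain \<sigma> where \<sigma>: "0 < \<sigma>" "\<sigma> < s" and 1: "\<phi> s - \<phi> 0 = s * (frechet_derivative f (at (x + \<sigma> *\<^sub>R a + s *\<^sub>R b)) a
        - frechet_derivative f (at (x + \<sigma> *\<^sub>R a)) a)" by auto
    have "\<exists>\<tau>. 0 < \<tau> \<and> \<tau> < s \<and> frechet_derivative f (at (x + \<sigma> *\<^sub>R a + s *\<^sub>R b)) a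
        - frechet_derivative f (at (x + \<sigma> *\<^sub>R a + 0 *\<^sub>R b)) a = (s - 0) * D a b (x + \<sigma> *\<^sub>R a + \<tau> *\<^sub>R b)"
    proof (rule MVT2[OF s])
      fix t assume t: "0 \<le> t" "t \<le> s"
      then have "x + \<sigma> *\<^sub>R a + t *\<^sub>R b \<in> S" using inS \<sigma> by auto
      from d[OF this smooth_on_frechet_derivative[OF assms(2)], of a]
      show "((\<lambda>t. frechet_derivative f (at (x + \<sigma> *\<^sub>R a + t *\<^sub>R b)) a) has_real_derivative
          D a b (x + \<sigma> *\<^sub>R a + t *\<^sub>R b)) (at t)" unfolding D_def .
    qed
    then obtain \<tau> where "0 < \<tau>" "\<tau> < s" and 2: "frechet_derivative f (at (x + \<sigma> *\<^sub>R a + s *\<^sub>R b)) a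
        - frechet_derivative f (at (x + \<sigma> *\<^sub>R a)) a = s * D a b (x + \<sigma> *\<^sub>R a + \<tau> *\<^sub>R b)" by auto
    moreover have "\<Delta> a b s = \<phi> s - \<phi> 0" by (simp add: \<Delta>_def \<phi>_def)
    ultimately show ?thesis using \<sigma> 1 by auto
  qed
  have cont: "continuous_on S (D a b)" for a b
    unfolding D_def by (intro smooth_on_continuous_on smooth_on_frechet_derivative assms)
  have "D a b x = D b a x"
  proof (rule ccontr)
    assume ne: "D a b x \<noteq> D b a x"
    define e where "e = \<bar>D a b x - D b a x\<bar> / 2"
    have "0 < e" using ne by (simp add: e_def)
    obtain r where r: "0 < r" "ball x r \<subseteq> S" using assms openE by blast
    have "isCont (D a b) x" for a b using cont assms continuous_on_eq_continuous_at by blast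
    then have "\<exists>d>0. \<forall>y. dist y x < d \<longrightarrow> dist (D a b y) (D a b x) < e" for a b
      using \<open>0 < e\<close> by (auto simp: continuous_at_eps_delta dist_norm)
    then obtain d1 d2 where d: "0 < d1" "\<And>y. dist y x < d1 \<Longrightarrow> dist (D a b y) (D a b x) < e"
      "0 < d2" "\<And>y. dist y x < d2 \<Longrightarrow> dist (D b a y) (D b a x) < e" by meson
    \<comment> \<open>The whole parallelogram then stays in S and where both mixed derivatives vary
      by less than e, half of the supposed gap; the summand 1 keeps the denominator
      positive.\<close>
    define s where "s = min r (min d1 d2) / (norm a + norm b + 1)"
    have s: "0 < s" using r d by (simp add: s_def add_nonneg_pos)
    have close: "dist (x + \<sigma> *\<^sub>R a + \<tau> *\<^sub>R b) x < min r (min d1 d2)"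
      if "0 \<le> \<sigma>" "\<sigma> \<le> s" "0 \<le> \<tau>" "\<tau> \<le> s" for \<sigma> \<tau>
    proof -
      have "norm (\<sigma> *\<^sub>R a + \<tau> *\<^sub>R b) \<le> \<sigma> * norm a + \<tau> * norm b"
        using norm_triangle_ineq[of "\<sigma> *\<^sub>R a" "\<tau> *\<^sub>R b"] that by simp
      also have "\<dots> \<le> s * norm a + s * norm b"
        using that by (intro add_mono mult_right_mono) auto
      also have "\<dots> < s * (norm a + norm b + 1)" using s by (simp add: algebra_simps)
      also have "\<dots> = min r (min d1 d2)"
        using add_nonneg_pos[of "norm a + norm b" 1] by (simp add: s_def)
      finally show ?thesis by (simp add: dist_norm add.assoc)
    qed
    have sw: "x + \<sigma> *\<^sub>R b + \<tau> *\<^sub>R a = x + \<tau> *\<^sub>R a + \<sigma> *\<^sub>R b" for \<sigma> \<tau> by (simp add: algebra_simps)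
    have in_S: "x + \<sigma> *\<^sub>R a + \<tau> *\<^sub>R b \<in> S" if "0 \<le> \<sigma>" "\<sigma> \<le> s" "0 \<le> \<tau>" "\<tau> \<le> s" for \<sigma> \<tau>
      using close[OF that] r by (auto simp: dist_commute)
    obtain \<sigma> \<tau> where 1: "0 < \<sigma>" "\<sigma> < s" "0 < \<tau>" "\<tau> < s" "\<Delta> a b s = s * s * D a b (x + \<sigma> *\<^sub>R a + \<tau> *\<^sub>R b)"
      using mean[OF s] in_S by blast
    obtain \<sigma>' \<tau>' where 2: "0 < \<sigma>'" "\<sigma>' < s" "0 < \<tau>'" "\<tau>' < s" "\<Delta> b a s = s * s * D b a (x + \<sigma>' *\<^sub>R b + \<tau>' *\<^sub>R a)"
      using mean[OF s, of b a] in_S by (metis sw)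
    have "\<Delta> a b s = \<Delta> b a s" by (simp add: \<Delta>_def algebra_simps)
    then have "D a b (x + \<sigma> *\<^sub>R a + \<tau> *\<^sub>R b) = D b a (x + \<sigma>' *\<^sub>R b + \<tau>' *\<^sub>R a)" using 1 2 s by simp
    moreover have "dist (D a b (x + \<sigma> *\<^sub>R a + \<tau> *\<^sub>R b)) (D a b x) < e"
      using d(2) close[of \<sigma> \<tau>] 1 by auto
    moreover have "dist (D b a (x + \<sigma>' *\<^sub>R b + \<tau>' *\<^sub>R a)) (D b a x) < e"
      unfolding sw using d(4) close[of \<tau>' \<sigma>'] 2 by auto
    ultimately show False unfolding e_def dist_real_def by argo
  qed
  then show ?thesis by (simp add: D_def)
qed

section \<open>Determinants\<close>

lemma det_add_row_multiples:
  fixes b :: "'k::finite \<Rightarrow> real ^ 'k"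
  assumes "k \<notin> S"
  shows "det (\<chi> l. if l = k then u else if l \<in> S then b l + c l *s u else b l) = det (\<chi> l. if l = k then u else b l)"
proof -
  have "finite S" by simp
  then show ?thesis using assms
  proof (induction S)
    case (insert i S)
    let ?A = "\<chi> l. if l = k then u else if l \<in> S then b l + c l *s u else b l"
    have "(\<chi> l. if l = k then u else if l \<in> insert i S then b l + c l *s u else b l)
        = (\<chi> l. if l = i then row i ?A + c i *s row k ?A else row l ?A)"
      using insert.hyps insert.prems by (auto simp: vec_eq_iff row_def)
    with det_row_operation[of i k ?A "c i"] insert show ?case by auto
  qed (simp cong: if_cong)
qed

text \<open>Linearity splits one row at a time. Once u occurs as a row, row operations strip its
  multiples from all others, so no product of two of the coefficients c survives.\<close>

lemma det_add_row_multiples_sum: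
  fixes b :: "'k::finite \<Rightarrow> real ^ 'k"
  shows "det (\<chi> l. if l \<in> S then b l + c l *s u else b l)
       = det (\<chi> l. b l) + (\<Sum>k\<in>S. c k * det (\<chi> l. if l = k then u else b l))"
proof -
  have "finite S" by simp
  then show ?thesis
  proof (induction S)
    case (insert i S)
    let ?f = "\<lambda>l. if l \<in> S then b l + c l *s u else b l"
    have "det (\<chi> l. if l \<in> insert i S then b l + c l *s u else b l)
        = det (\<chi> l. if l = i then b i + c i *s u else ?f l)"
      by (rule arg_cong[of _ _ det]) (auto simp: vec_eq_iff)
    also have "\<dots> = det (\<chi> l. if l = i then b i else ?f l) + c i * det (\<chi> l. if l = i then u else ?f l)"
      by (simp only: det_row_add det_row_mul)
    also have "(\<chi> l. if l = i then b i else ?f l) = (\<chi> l. ?f l)"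
      using insert.hyps by (auto simp: vec_eq_iff)
    also have "det (\<chi> l. if l = i then u else ?f l) = det (\<chi> l. if l = i then u else b l)"
      by (rule det_add_row_multiples[OF insert.hyps(2)])
    finally show ?case using insert by simp
  qed (simp cong: if_cong)
qed

section \<open>Adjugates and rank-one updates\<close>

lemma det_replace_row_axis:
  fixes A :: "real ^ 'k ^ 'k::finite"
  shows "det (\<chi> k l. if k = j then (if l = i then 1 else 0) else A $ k $ l)
       = det (\<chi> k l. if k = j \<or> l = i then of_bool (k = j \<and> l = i) else A $ k $ l)"
proof -
  let ?b = "\<lambda>k. \<chi> l. if l = i then 0 else A $ k $ l"
  have "(\<chi> k l. if k = j \<or> l = i then of_bool (k = j \<and> l = i) else A $ k $ l)
      = (\<chi> k. if k = j then axis i 1 else ?b k)"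
    by (auto simp: vec_eq_iff axis_def)
  moreover have "(\<chi> k l. if k = j then (if l = i then 1 else 0) else A $ k $ l)
      = (\<chi> k. if k = j then axis i 1 else if k \<in> - {j} then ?b k + (A $ k $ i) *s axis i 1 else ?b k)"
    by (auto simp: vec_eq_iff axis_def)
  ultimately show ?thesis
    using det_add_row_multiples[of j "- {j}" "axis i 1" ?b "\<lambda>k. A $ k $ i"] by simp
qed

text \<open>The definition replaces a column, the row expansions below need a replaced row. A line
  equal to a standard basis vector allows the line crossing it at the entry 1 to be cleared as well,
  and the fully cleared matrix is the same in both cases.\<close>

lemma adjugate_eq_row:
  fixes A :: "real ^ 'k ^ 'k::finite"
  shows "adjugate A $ i $ j = det (\<chi> k. if k = j then axis i 1 else row k A)"
proof -
  have "adjugate A $ i $ j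
      = det (transpose (\<chi> k l. if k = i then (if l = j then 1 else 0) else transpose A $ k $ l))"
    unfolding adjugate_def vec_lambda_beta
    by (rule arg_cong[of _ _ det]) (auto simp: vec_eq_iff transpose_def)
  also have "\<dots> = det (\<chi> k l. if k = i \<or> l = j then of_bool (k = i \<and> l = j) else transpose A $ k $ l)"
    by (simp only: det_transpose det_replace_row_axis)
  also have "\<dots> = det (transpose (\<chi> k l. if k = j \<or> l = i then of_bool (k = j \<and> l = i) else A $ k $ l))"
    by (rule arg_cong[of _ _ det]) (auto simp: vec_eq_iff transpose_def)
  also have "\<dots> = det (\<chi> k l. if k = j then (if l = i then 1 else 0) else A $ k $ l)"
    by (simp only: det_transpose det_replace_row_axis)
  also have "\<dots> = det (\<chi> k. if k = j then axis i 1 else row k A)"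
    by (rule arg_cong[of _ _ det]) (auto simp: vec_eq_iff axis_def row_def)
  finally show ?thesis .
qed

lemma adjugate_transpose:
  fixes A :: "real ^ 'k ^ 'k::finite"
  shows "adjugate (transpose A) = transpose (adjugate A)"
proof -
  have "adjugate (transpose A) $ i $ j = adjugate A $ j $ i" for i j
    unfolding adjugate_eq_row[of "transpose A"] unfolding adjugate_def vec_lambda_beta
    by (subst det_transpose[symmetric], rule arg_cong[of _ _ det])
      (auto simp: vec_eq_iff transpose_def row_def axis_def)
  then show ?thesis by (simp add: vec_eq_iff transpose_def)
qed

text \<open>For a singular matrix this does not follow from \<open>adjugate_mult\<close> by
  inverting; it is the transpose of that identity for \<open>transpose A\<close>.\<close>

lemma mult_adjugate:
  fixes A :: "real ^ 'k ^ 'k::finite"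
  shows "A ** adjugate A = mat (det A)"
proof -
  have "transpose (A ** adjugate A) = adjugate (transpose A) ** transpose A"
    by (simp add: matrix_transpose_mul adjugate_transpose)
  then have "transpose (A ** adjugate A) = transpose (mat (det A))"
    by (simp add: adjugate_mult transpose_mat)
  then show ?thesis by (metis transpose_transpose)
qed

lemma matrix_inv_eq_adjugate:
  fixes A :: "real ^ 'k ^ 'k::finite"
  assumes "det A \<noteq> 0"
  shows "matrix_inv A = inverse (det A) *\<^sub>R adjugate A"
proof -
  have "(inverse (det A) *\<^sub>R adjugate A) ** A = mat 1"
    using assms adjugate_mult[of A]
    by (simp add: vec_eq_iff matrix_matrix_mult_def mat_def mult.assoc flip: sum_distrib_left)
  moreover have "A ** matrix_inv A = mat 1"
    using assms someI_ex[of "\<lambda>B. A ** B = mat 1 \<and> B ** A = mat 1"]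
    by (auto simp: matrix_inv_def invertible_def simp flip: invertible_det_nz)
  ultimately show ?thesis
    by (metis matrix_mul_assoc matrix_mul_lid matrix_mul_rid)
qed

text \<open>A rank-one update adds a multiple of v to every row, so the expansion stops at first
  order in u, and the determinants with one row replaced by v assemble into v times the adjugate.
  With the adjugate in place of an inverse, A may be singular, as the Hessian may be.\<close>

theorem matrix_determinant_lemma:
  fixes A :: "real ^ 'k ^ 'k::finite"
  shows "det (\<chi> i j. A $ i $ j + u $ i * v $ j) = det A + v \<bullet> (adjugate A *v u)"
proof -
  have row: "det (\<chi> l. if l = k then v else row l A) = (\<Sum>i\<in>UNIV. v $ i * adjugate A $ i $ k)" for k
  proof -
    have "v = (\<Sum>i\<in>UNIV. (v $ i) *s axis i 1)"
      by (simp add: vec_eq_iff axis_def if_distrib cong: if_cong)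
    then have "det (\<chi> l. if l = k then v else row l A)
        = det (\<chi> l. if l = k then (\<Sum>i\<in>UNIV. (v $ i) *s axis i 1) else row l A)"
      by (rule arg_cong[where f = "\<lambda>v. det (\<chi> l. if l = k then v else row l A)"])
    also have "\<dots> = (\<Sum>i\<in>UNIV. v $ i * adjugate A $ i $ k)"
      by (subst det_linear_row_sum) (simp_all add: det_row_mul adjugate_eq_row)
    finally show ?thesis .
  qed
  have "det (\<chi> i j. A $ i $ j + u $ i * v $ j) = det (\<chi> k. if k \<in> UNIV then row k A + (u $ k) *s v else row k A)"
    by (rule arg_cong[of _ _ det]) (auto simp: vec_eq_iff row_def)
  also have "\<dots> = det (\<chi> k. row k A) + (\<Sum>k\<in>UNIV. u $ k * det (\<chi> l. if l = k then v else row l A))"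
    by (rule det_add_row_multiples_sum)
  also have "(\<chi> k. row k A) = A" by (simp add: vec_eq_iff row_def)
  also have "(\<Sum>k\<in>UNIV. u $ k * det (\<chi> l. if l = k then v else row l A)) = v \<bullet> (adjugate A *v u)"
    unfolding row inner_vec_def matrix_vector_mult_def
    by (simp add: sum_distrib_left mult_ac) (rule sum.swap)
  finally show ?thesis .
qed

text \<open>All terms but j = k have two equal rows. Summed over the rows, this is how a trace
  appears in the derivative of a volume form.\<close>

lemma det_replace_row_combination:
  fixes a :: "'k::finite \<Rightarrow> real ^ 'k"
  shows "det (\<chi> l. if l = k then (\<Sum>j\<in>UNIV. c j *\<^sub>R a j) else a l) = c k * det (\<chi> l. a l)"
proof -
  have "det (\<chi> l. if l = k then (\<Sum>j\<in>UNIV. c j *\<^sub>R a j) else a l)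
      = (\<Sum>j\<in>UNIV. c j * det (\<chi> l. if l = k then a j else a l))"
    unfolding scalar_mult_eq_scaleR[symmetric]
    by (subst det_linear_row_sum) (simp_all add: det_row_mul)
  also have "\<dots> = (\<Sum>j\<in>UNIV. if j = k then c k * det (\<chi> l. a l) else 0)"
  proof (rule sum.cong)
    fix j
    have "(\<chi> l. if l = k then a k else a l) = (\<chi> l. a l)" by (auto simp: vec_eq_iff)
    moreover have "det (\<chi> l. if l = k then a j else a l) = 0" if "j \<noteq> k"
      by (rule det_identical_rows[of k j]) (use that in \<open>auto simp: row_def vec_eq_iff\<close>)
    ultimately show "c j * det (\<chi> l. if l = k then a j else a l) = (if j = k then c k * det (\<chi> l. a l) else 0)"
      by auto
  qed simp
  finally show ?thesis by simp
qed

lemma det_has_derivative: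
  fixes f :: "'a::real_normed_vector \<Rightarrow> 'k::finite \<Rightarrow> real ^ 'k"
  assumes "\<And>k. ((\<lambda>x. f x k) has_derivative f' k) (at x within S)"
  shows "((\<lambda>x. det (\<chi> k. f x k)) has_derivative (\<lambda>h. \<Sum>k\<in>UNIV. det (\<chi> l. if l = k then f' k h else f x l))) (at x within S)"
proof -
  have d: "((\<lambda>x. f x k $ j) has_derivative (\<lambda>h. f' k h $ j)) (at x within S)" for k j
    using assms bounded_linear.has_derivative[OF bounded_linear_vec_nth] by blast
  have "((\<lambda>x. det (\<chi> k. f x k)) has_derivative
      (\<lambda>h. \<Sum>p | p permutes UNIV. of_int (sign p) * (\<Sum>k\<in>UNIV. f' k h $ p k * (\<Prod>l\<in>UNIV - {k}. f x l $ p l)))) (at x within S)"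
    unfolding det_def vec_lambda_beta
    by (intro has_derivative_sum has_derivative_mult_right has_derivative_prod d)
  moreover have "(\<Sum>p | p permutes UNIV. of_int (sign p) * (\<Sum>k\<in>UNIV. f' k h $ p k * (\<Prod>l\<in>UNIV - {k}. f x l $ p l)))
      = (\<Sum>k\<in>UNIV. det (\<chi> l. if l = k then f' k h else f x l))" for h
  proof -
    have "(\<Prod>l\<in>UNIV. (if l = k then f' k h else f x l) $ p l) = f' k h $ p k * (\<Prod>l\<in>UNIV - {k}. f x l $ p l)"
      for k and p :: "'k \<Rightarrow> 'k"
      by (subst prod.remove[of _ k]) auto
    then show ?thesis
      unfolding det_def vec_lambda_beta by (simp add: sum_distrib_left) (rule sum.swap)
  qed
  ultimately show ?thesis by simp
qed

text \<open>In the row \<open>None\<close> only the diagonal entry can be nonzero, so only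
  permutations fixing \<open>None\<close> contribute, and \<open>Some\<close> carries the
  permutations of \<open>'m\<close> to these.\<close>

lemma det_option_block:
  fixes B :: "real ^ 'm option ^ 'm::finite option"
  assumes "\<And>j. B $ None $ Some j = 0"
  shows "det B = B $ None $ None * det (\<chi> i j. B $ Some i $ Some j)"
proof -
  let ?s = "\<lambda>p. of_int (sign p) * (\<Prod>x\<in>UNIV. B $ x $ p x)"
  have inj: "inj_on Some (UNIV :: 'm set)" by simp
  have "det B = (\<Sum>p | p permutes range Some. ?s p)"
    unfolding det_def
  proof (rule sum.mono_neutral_right)
    show "\<forall>p\<in>{p. p permutes UNIV} - {p. p permutes range Some}. ?s p = 0"
    proof
      fix p :: "'m option \<Rightarrow> 'm option"
      assume p: "p \<in> {p. p permutes UNIV} - {p. p permutes range Some}"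
      have "p None \<noteq> None"
      proof
        assume None: "p None = None"
        have "p permutes range Some"
        proof (rule permutes_superset)
          show "p permutes UNIV" using p by simp
          show "p x = x" if "x \<in> UNIV - range Some" for x
            using None that by (cases x) auto
        qed
        with p show False by simp
      qed
      then obtain j where "p None = Some j" by auto
      then have "B $ None $ p None = 0" using assms by simp
      then show "?s p = 0" by (auto intro!: prod_zero)
    qed
  qed (auto intro: permutes_subset)
  also have "\<dots> = (\<Sum>q | q permutes UNIV. ?s (map_permutation UNIV Some q))"
  proof (rule sum.reindex_bij_witness[of _ "map_permutation UNIV Some" "map_permutation (range Some) the"])
    fix p :: "'m option \<Rightarrow> 'm option"
    assume "p \<in> {p. p permutes range Some}"
    then have p: "p permutes range Some" by simp
    have bij: "bij_betw the (range Some) (UNIV :: 'm set)"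
      by (rule bij_betw_byWitness[where f' = Some]) auto
    show "map_permutation (range Some) the p \<in> {q. q permutes (UNIV :: 'm set)}"
      using map_permutation_permutes[OF bij p] by simp
    show "map_permutation UNIV Some (map_permutation (range Some) the p) = p"
      by (rule map_permutation_compose_inv[OF bij p]) auto
    then show "?s (map_permutation UNIV Some (map_permutation (range Some) the p)) = ?s p" by simp
  next
    fix q :: "'m \<Rightarrow> 'm"
    assume "q \<in> {q. q permutes UNIV}"
    then have q: "q permutes UNIV" by simp
    have bij: "bij_betw Some (UNIV :: 'm set) (range Some)" by (simp add: bij_betw_def)
    show "map_permutation UNIV Some q \<in> {p. p permutes range Some}"
      using map_permutation_permutes[OF bij q] by simp
    show "map_permutation (range Some) the (map_permutation UNIV Some q) = q"
      by (rule map_permutation_compose_inv[OF bij q]) auto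
  qed
  also have "\<dots> = (\<Sum>q | q permutes UNIV. B $ None $ None * (of_int (sign q) * (\<Prod>x\<in>UNIV. B $ Some x $ Some (q x))))"
  proof (rule sum.cong)
    fix q :: "'m \<Rightarrow> 'm"
    assume "q \<in> {q. q permutes UNIV}"
    then have q: "q permutes UNIV" by simp
    let ?p = "map_permutation UNIV Some q"
    have "sign ?p = sign q" by (rule sign_map_permutation[OF inj q]) simp
    moreover have "?p None = None" by (simp add: map_permutation_def restrict_id_def)
    moreover have "?p (Some x) = Some (q x)" for x by (rule map_permutation_apply[OF inj]) simp
    ultimately show "?s ?p = B $ None $ None * (of_int (sign q) * (\<Prod>x\<in>UNIV. B $ Some x $ Some (q x)))"
      by (simp add: UNIV_option_conv prod.reindex)
  qed simp
  finally show ?thesis by (simp add: det_def sum_distrib_left)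
qed

section \<open>The volume form on tangent vectors completed by a transversal\<close>

lemma det_orthogonal_rows:
  fixes A :: "real ^ 'k ^ 'k::finite"
  assumes "g \<noteq> 0" "\<And>k. g \<bullet> row k A = 0"
  shows "det A = 0"
proof -
  have "A *v g = 0" using assms(2) by (simp add: vec_eq_iff matrix_vector_mult_def inner_vec_def row_def mult.commute)
  then have "\<not> invertible A"
    using assms(1) by (metis invertible_def matrix_left_invertible_ker)
  then show ?thesis using invertible_det_nz by blast
qed

text \<open>The vector \<open>T - c *s N\<close> lies in the hyperplane annihilated by g, as do all
  \<open>Y i\<close>; n + 1 vectors in a hyperplane have determinant 0.\<close>

lemma Psi_change_transversal:
  fixes Y :: "'m::finite \<Rightarrow> real ^ 'm option"
  assumes "g \<noteq> 0" "\<And>i. g \<bullet> Y i = 0" "g \<bullet> T = c * (g \<bullet> N)"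
  shows "Psi (case_option T Y) = c * Psi (case_option N Y)"
proof -
  let ?b = "case_option 0 Y"
  have eq: "(\<chi> k. case_option X Y k) = (\<chi> k. if k = None then X else ?b k)" for X
    by (auto simp: vec_eq_iff split: option.split)
  have "Psi (case_option T Y) = det (\<chi> k. if k = None then (T - c *s N) + c *s N else ?b k)"
    unfolding Psi_def eq by (simp cong: if_cong)
  also have "\<dots> = det (\<chi> k. if k = None then T - c *s N else ?b k) + c * Psi (case_option N Y)"
    unfolding Psi_def eq by (simp only: det_row_add det_row_mul)
  also have "det (\<chi> k. if k = None then T - c *s N else ?b k) = 0"
    by (rule det_orthogonal_rows[OF assms(1)])
      (use assms in \<open>auto simp: row_def scalar_mult_eq_scaleR inner_diff_right split: option.split\<close>)
  finally show ?thesis by simp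
qed

text \<open>The Gram matrix of N, Y_1, ..., Y_n with respect to M is evaluated twice: as a product
  of determinants, and as a block matrix, since N is M-orthogonal to every \<open>Y i\<close>. Its
  corner entry is det M times g \<bullet> N, so det M cancels.\<close>

lemma Psi_square_eq:
  fixes M :: "real ^ 'm option ^ 'm::finite option"
  assumes "transpose M = M" "M *v N = det M *\<^sub>R g" "det M \<noteq> 0" "\<And>i. g \<bullet> Y i = 0"
  shows "(Psi (case_option N Y))\<^sup>2 = (g \<bullet> N) * det (\<chi> i j. Y i \<bullet> (M *v Y j))"
proof -
  define R where "R = (\<chi> k. case_option N Y k)"
  define B where "B = R ** M ** transpose R"
  have B: "B $ k $ l = case_option N Y k \<bullet> (M *v case_option N Y l)" for k l
  proof -
    have "B $ k $ l = (\<Sum>j\<in>UNIV. \<Sum>i\<in>UNIV. R $ k $ i * M $ i $ j * R $ l $ j)"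
      by (simp add: B_def matrix_matrix_mult_def transpose_def sum_distrib_right)
    also have "\<dots> = (\<Sum>i\<in>UNIV. \<Sum>j\<in>UNIV. R $ k $ i * M $ i $ j * R $ l $ j)" by (rule sum.swap)
    also have "\<dots> = R $ k \<bullet> (M *v R $ l)"
      by (simp add: inner_vec_def matrix_vector_mult_def sum_distrib_left mult_ac)
    finally show ?thesis by (simp add: R_def)
  qed
  have sym: "x \<bullet> (M *v y) = y \<bullet> (M *v x)" for x y
    by (metis assms(1) dot_lmul_matrix inner_commute matrix_vector_mul_component vector_transpose_matrix transpose_matrix_vector)
  have "det B = B $ None $ None * det (\<chi> i j. B $ Some i $ Some j)"
  proof (rule det_option_block)
    fix j
    have "N \<bullet> (M *v Y j) = det M * (g \<bullet> Y j)" by (simp add: sym[of N] assms(2) inner_commute)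
    then show "B $ None $ Some j = 0" by (simp add: B assms(4))
  qed
  moreover have "det B = (Psi (case_option N Y))\<^sup>2 * det M"
    by (simp add: B_def det_mul Psi_def R_def power2_eq_square)
  ultimately show ?thesis
    using assms(2,3) by (simp add: B inner_commute)
qed

lemma exists_orthogonal_frame:
  fixes g :: "real ^ 'm::finite option"
  assumes "g \<noteq> 0"
  obtains v :: "'m \<Rightarrow> real ^ 'm option"
  where "\<And>i. g \<bullet> v i = 0" "\<And>w. g \<bullet> w \<noteq> 0 \<Longrightarrow> Psi (case_option w v) \<noteq> 0"
proof -
  obtain k where k: "g $ k \<noteq> 0" using assms by (auto simp: vec_eq_iff)
  \<comment> \<open>The indices \<open>s (Some i)\<close> run through the coordinates other than k.
    Their basis vectors are pushed into the hyperplane along the k-th axis, which works because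
    \<open>g $ k\<close> is nonzero.\<close>
  define s where "s = Transposition.transpose None k"
  define v :: "'m \<Rightarrow> real ^ 'm option" where "v i = axis (s (Some i)) 1 - (g $ s (Some i) / g $ k) *\<^sub>R axis k 1" for i
  have v: "v i \<bullet> x = x $ s (Some i) - g $ s (Some i) / g $ k * x $ k" for i x
    by (simp add: v_def inner_diff_left inner_axis inner_commute[of "axis _ _"])
  show ?thesis
  proof
    show "g \<bullet> v i = 0" for i using k by (simp add: inner_commute[of g] v)
    show "Psi (case_option w v) \<noteq> 0" if w: "g \<bullet> w \<noteq> 0" for w
    proof -
      have "x = 0" if x: "(\<chi> k. case_option w v k) *v x = 0" for x
      proof -
        have x0: "case_option w v l \<bullet> x = 0" for l
          using arg_cong[OF x, of "\<lambda>y. y $ l"] by (simp add: matrix_vector_mult_def inner_vec_def)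
        \<comment> \<open>Orthogonality to all \<open>v i\<close> makes x a multiple of g;
          orthogonality to w then forces the factor to vanish.\<close>
        have xl: "x $ l = x $ k / g $ k * g $ l" for l
        proof (cases "s l")
          case None
          then have "l = k" by (metis s_def transpose_apply_first transpose_involutory)
          then show ?thesis using k by simp
        next
          case (Some i)
          then have l: "l = s (Some i)" by (metis s_def transpose_involutory)
          show ?thesis using x0[of "Some i"] v[of i x] unfolding l by simp
        qed
        have xg: "x = (x $ k / g $ k) *\<^sub>R g"
          by (rule vec_eq_iff[THEN iffD2], rule allI, rule trans[OF xl]) simp
        from arg_cong[OF this, of "\<lambda>x. w \<bullet> x"] have "w \<bullet> x = (x $ k / g $ k) * (w \<bullet> g)"
          by (simp only: inner_scaleR_right)
        then have "x $ k / g $ k = 0" using x0[of None] w by (simp add: inner_commute)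
        with xg show ?thesis by (metis scaleR_zero_left)
      qed
      then have "invertible (\<chi> k. case_option w v k)"
        by (metis invertible_left_inverse matrix_left_invertible_ker)
      then show ?thesis by (simp add: Psi_def invertible_det_nz)
    qed
  qed
qed

lemma Psi_nonzero_imp_combination:
  fixes a :: "'m::finite option \<Rightarrow> real ^ 'm option"
  assumes "Psi a \<noteq> 0"
  obtains c where "x = (\<Sum>k\<in>UNIV. c k *\<^sub>R a k)"
proof -
  have "invertible (transpose (\<chi> k. a k))"
    using assms by (simp add: Psi_def invertible_det_nz)
  then obtain B where "transpose (\<chi> k. a k) ** B = mat 1" by (auto simp: invertible_def)
  then have "x = transpose (\<chi> k. a k) *v (B *v x)"
    by (simp add: matrix_vector_mul_assoc)
  also have "transpose (\<chi> k. a k) *v y = (\<Sum>k\<in>UNIV. (y $ k) *\<^sub>R a k)" for y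
    by (simp add: vec_eq_iff matrix_vector_mult_def transpose_def mult.commute)
  finally show ?thesis by (rule that)
qed

lemma Psi_nonzero_if_independent:
  fixes Y :: "'m::finite \<Rightarrow> real ^ 'm option"
  assumes "inj Y" "independent (range Y)" "\<And>i. g \<bullet> Y i = 0" "g \<bullet> T \<noteq> 0"
  shows "Psi (case_option T Y) \<noteq> 0"
proof -
  let ?R = "\<chi> k. case_option T Y k"
  have "\<forall>k. c k = 0" if c: "(\<Sum>k\<in>UNIV. c k *s row k ?R) = 0" for c
  proof -
    have c': "c None *\<^sub>R T + (\<Sum>i\<in>UNIV. c (Some i) *\<^sub>R Y i) = 0"
      using c by (simp add: UNIV_option_conv sum.reindex row_def scalar_mult_eq_scaleR)
    from arg_cong[OF this, of "\<lambda>x. g \<bullet> x"] have "c None * (g \<bullet> T) = 0"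
      using assms(3) by (simp add: inner_add_right inner_sum_right)
    then have c0: "c None = 0" using assms(4) by simp
    \<comment> \<open>\<open>independent\<close> speaks of the set \<open>range Y\<close>;
      injectivity lets \<open>inv Y\<close> transport the indexed coefficients to it.\<close>
    have "(\<Sum>y\<in>range Y. c (Some (inv Y y)) *\<^sub>R y) = 0"
      using c' c0 assms(1) by (simp add: sum.reindex)
    then have "c (Some (inv Y (Y i))) = 0" for i
      using assms(2) independentD[of "range Y" "range Y" "\<lambda>y. c (Some (inv Y y))" "Y i"] by simp
    then have "c (Some i) = 0" for i using assms(1) by simp
    with c0 show ?thesis by (metis not_Some_eq)
  qed
  then have "\<exists>B. ?R ** B = mat 1" using matrix_right_invertible_independent_rows by blast
  then have "invertible ?R" using invertible_right_inverse by blast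
  then show ?thesis by (simp add: Psi_def invertible_det_nz)
qed

lemma independent_if_Psi_nonzero:
  fixes Y :: "'m::finite \<Rightarrow> real ^ 'm option"
  assumes "Psi (case_option T Y) \<noteq> 0"
  shows "inj Y" "independent (range Y)"
proof -
  let ?R = "\<chi> k. case_option T Y k"
  have "invertible ?R" using assms by (simp add: Psi_def invertible_det_nz)
  then have ind: "(\<Sum>k\<in>UNIV. c k *s row k ?R) = 0 \<Longrightarrow> c k = 0" for c k
    using matrix_right_invertible_independent_rows[of ?R] invertible_right_inverse by blast
  show inj: "inj Y"
  proof (rule ccontr)
    assume "\<not> inj Y"
    then obtain i j where "i \<noteq> j" "Y i = Y j" by (auto simp: inj_def)
    then have "det ?R = 0"
      by (intro det_identical_rows[of "Some i" "Some j"]) (auto simp: row_def)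
    with assms show False by (simp add: Psi_def)
  qed
  show "independent (range Y)"
  proof (rule independent_if_scalars_zero)
    fix f x assume f: "(\<Sum>x\<in>range Y. f x *\<^sub>R x) = 0" and "x \<in> range Y"
    then obtain i where i: "x = Y i" by auto
    have "(\<Sum>k\<in>UNIV. case_option 0 (f \<circ> Y) k *s row k ?R) = 0"
      using f inj by (simp add: UNIV_option_conv sum.reindex row_def scalar_mult_eq_scaleR)
    from ind[OF this, of "Some i"] show "f x = 0" by (simp add: i)
  qed simp
qed

lemma det_scale_entries:
  fixes B :: "'m::finite \<Rightarrow> 'm \<Rightarrow> real"
  shows "det (\<chi> i j. c * B i j) = c ^ CARD('m) * det (\<chi> i j. B i j)"
proof -
  have "(\<chi> i j. c * B i j) = (\<chi> i. c *s (\<chi> j. B i j))" by (simp add: vec_eq_iff)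
  then show ?thesis by (simp add: det_rows_mul)
qed

section \<open>Regular level sets\<close>

lemma frechet_derivative_eq_grad:
  assumes "F differentiable (at x)"
  shows "frechet_derivative F (at x) v = grad F x \<bullet> v"
proof -
  have lin: "linear (frechet_derivative F (at x))" by (rule linear_frechet_derivative[OF assms])
  have "v = (\<Sum>i\<in>UNIV. (v $ i) *\<^sub>R axis i 1)"
    by (simp add: vec_eq_iff axis_def if_distrib cong: if_cong)
  then have "frechet_derivative F (at x) v = frechet_derivative F (at x) (\<Sum>i\<in>UNIV. (v $ i) *\<^sub>R axis i 1)"
    by (rule arg_cong)
  also have "\<dots> = grad F x \<bullet> v"
    by (simp add: linear_sum[OF lin] linear_scale[OF lin] grad_def partial_deriv_def inner_vec_def mult.commute)
  finally show ?thesis .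
qed

lemma smooth_on_grad_has_derivative:
  assumes "smooth_on S F" "x \<in> S"
  shows "(F has_derivative (\<lambda>v. grad F x \<bullet> v)) (at x)"
proof -
  have "frechet_derivative F (at x) = (\<lambda>v. grad F x \<bullet> v)"
    using smooth_on_has_derivative[OF assms] frechet_derivative_eq_grad
    by (auto simp: differentiable_def fun_eq_iff)
  with smooth_on_has_derivative[OF assms] show ?thesis by simp
qed

lemma smooth_on_partial_deriv: "smooth_on S F \<Longrightarrow> smooth_on S (partial_deriv i F)"
  using smooth_on_frechet_derivative[of S F "axis i 1"] by (simp add: partial_deriv_def[abs_def])

lemma smooth_on_grad_nth: "smooth_on S F \<Longrightarrow> smooth_on S (\<lambda>x. grad F x $ i)"
  by (simp add: grad_def smooth_on_partial_deriv)

lemma smooth_on_grad: "open S \<Longrightarrow> smooth_on S F \<Longrightarrow> smooth_on S (grad F)"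
  unfolding grad_def[abs_def] by (intro smooth_on_vec smooth_on_partial_deriv)

lemma smooth_on_hess: "smooth_on S F \<Longrightarrow> smooth_on S (\<lambda>x. hess F x $ i $ j)"
  by (simp add: hess_def smooth_on_partial_deriv)

lemma smooth_on_adjugate:
  fixes A :: "'a::euclidean_space \<Rightarrow> real ^ 'k::finite ^ 'k"
  assumes "open S" "\<And>i j. smooth_on S (\<lambda>x. A x $ i $ j)"
  shows "smooth_on S (\<lambda>x. adjugate (A x) $ i $ j)"
  unfolding adjugate_def vec_lambda_beta
proof (rule smooth_on_det[OF assms(1)])
  fix k l
  show "smooth_on S (\<lambda>x. (\<chi> k l. if l = i then if k = j then 1 else 0 else A x $ k $ l) $ k $ l)"
    using assms by (cases "l = i"; cases "k = j") (auto intro: smooth_on_const)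
qed

lemma smooth_on_N_field: "open S \<Longrightarrow> smooth_on S F \<Longrightarrow> smooth_on S (N_field F)"
  unfolding N_field_def[abs_def]
  by (intro smooth_on_vec smooth_on_sum smooth_on_mult smooth_on_adjugate smooth_on_hess smooth_on_grad_nth)

lemma smooth_on_U_fun: "open S \<Longrightarrow> smooth_on S F \<Longrightarrow> smooth_on S (U_fun F)"
  unfolding U_fun_def[abs_def]
  by (intro smooth_on_sum smooth_on_mult smooth_on_adjugate smooth_on_hess smooth_on_grad_nth)

lemma hess_symmetric:
  assumes "open S" "smooth_on S F" "x \<in> S"
  shows "transpose (hess F x) = hess F x"
  using frechet_derivative_symmetric[OF assms]
  by (simp add: vec_eq_iff transpose_def hess_def partial_deriv_def[abs_def])

lemma grad_has_derivative:
  assumes "open S" "smooth_on S F" "x \<in> S"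
  shows "(grad F has_derivative (\<lambda>v. hess F x *v v)) (at x)"
proof -
  have "((\<lambda>y. grad F y $ i) has_derivative (\<lambda>v. (hess F x *v v) $ i)) (at x)" for i
  proof -
    have "grad (partial_deriv i F) x = hess F x $ i"
      using arg_cong[OF hess_symmetric[OF assms], of "\<lambda>A. A $ i"]
      by (simp add: grad_def[of "partial_deriv i F"] hess_def transpose_def)
    then show ?thesis
      using smooth_on_grad_has_derivative[OF smooth_on_partial_deriv[OF assms(2)] assms(3), of i]
      by (simp add: grad_def inner_vec_def matrix_vector_mult_def)
  qed
  then show ?thesis
    by (auto simp: has_derivative_componentwise_within[of "grad F"] Basis_vec_def inner_axis)
qed

lemma inner_matrix_vector_symmetric:
  fixes A :: "real ^ 'k ^ 'k::finite"
  assumes "transpose A = A"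
  shows "x \<bullet> (A *v y) = y \<bullet> (A *v x)"
  by (metis assms dot_lmul_matrix inner_commute transpose_matrix_vector)

lemma has_derivative_transform_openin:
  assumes "openin (top_of_set \<Sigma>) V" "p \<in> V" "(f has_derivative L) (at p within \<Sigma>)"
    and "\<And>x. x \<in> V \<Longrightarrow> f x = g x"
  shows "(g has_derivative L) (at p within \<Sigma>)"
proof -
  obtain O' where O': "open O'" "V = \<Sigma> \<inter> O'" using assms(1) by (auto simp: openin_open)
  obtain e where e: "0 < e" "ball p e \<subseteq> O'"
    using O' assms(2) by (metis IntD2 openE)
  show ?thesis
    by (rule has_derivative_transform_within[OF assms(3) e(1)])
      (use O' e assms(2,4) in \<open>auto simp: dist_commute subset_iff\<close>)
qed

section \<open>Tangent spaces and derivatives along a regular level set\<close>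

locale regular_function =
  fixes \<Omega> :: "(real ^ 'm::finite option) set" and F :: "real ^ 'm option \<Rightarrow> real" and r :: real
  assumes open_\<Omega>: "open \<Omega>" and smooth_F: "smooth_on \<Omega> F"
    and grad_nonzero: "x \<in> \<Omega> \<Longrightarrow> grad F x \<noteq> 0"
begin

abbreviation \<Sigma> where "\<Sigma> \<equiv> level_set F \<Omega> r"

lemma mem_level_set: "x \<in> \<Sigma> \<longleftrightarrow> x \<in> \<Omega> \<and> F x = r"
  by (simp add: level_set_def)

lemmas F_has_derivative = smooth_on_grad_has_derivative[OF smooth_F]
  and gradF_has_derivative = grad_has_derivative[OF open_\<Omega> smooth_F]
  and hess_sym = hess_symmetric[OF open_\<Omega> smooth_F]
  and smooth_gradF = smooth_on_grad[OF open_\<Omega> smooth_F]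

lemma continuous_on_gradF: "continuous_on \<Omega> (grad F)"
  by (rule smooth_on_continuous_on[OF smooth_gradF])

lemma open_noncharacteristic: "open {x \<in> \<Omega>. grad F x \<bullet> w \<noteq> 0}"
proof -
  have "continuous_on \<Omega> (\<lambda>x. grad F x \<bullet> w)" by (intro continuous_intros continuous_on_gradF)
  from continuous_open_preimage[OF this open_\<Omega>, of "- {0}"]
  have "open (\<Omega> \<inter> (\<lambda>x. grad F x \<bullet> w) -` (- {0}))" by auto
  moreover have "\<Omega> \<inter> (\<lambda>x. grad F x \<bullet> w) -` (- {0}) = {x \<in> \<Omega>. grad F x \<bullet> w \<noteq> 0}" by auto
  ultimately show ?thesis by simp
qed

text \<open>The projection along w onto the kernel of dF. Near a point where dF does not annihilate
  w it extends tangent vectors to tangent fields, and it supplies the curves, extensions and frames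
  used below.\<close>

definition ker_proj where
  "ker_proj w v x = v - ((grad F x \<bullet> v) / (grad F x \<bullet> w)) *\<^sub>R w"

lemma grad_ker_proj: "grad F x \<bullet> w \<noteq> 0 \<Longrightarrow> grad F x \<bullet> ker_proj w v x = 0"
  by (simp add: ker_proj_def inner_diff_right)

lemma smooth_on_ker_proj: "smooth_on {x \<in> \<Omega>. grad F x \<bullet> w \<noteq> 0} (ker_proj w v)"
proof -
  let ?V = "{x \<in> \<Omega>. grad F x \<bullet> w \<noteq> 0}"
  have g: "smooth_on ?V (grad F)" by (rule smooth_on_subset[OF smooth_gradF]) auto
  show ?thesis
    unfolding ker_proj_def[abs_def] divide_inverse
    by (intro smooth_on_diff smooth_on_scaleR smooth_on_mult smooth_on_inverse smooth_on_inner
        smooth_on_const open_noncharacteristic g) auto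
qed

text \<open>The map \<open>x \<mapsto> x + (F x - F p - dF\<^sub>p (x - p)) w\<close>, where \<open>dF\<^sub>p w = 1\<close>, straightens the level set near \<open>p\<close>;
  the preimage of the line through \<open>p\<close> with tangent direction \<open>v\<close> is an integral curve of \<open>ker_proj w v\<close>.\<close>

lemma kernel_subset_tangent_space:
  assumes p: "p \<in> \<Sigma>" and v: "grad F p \<bullet> v = 0"
  shows "v \<in> tangent_space \<Sigma> p"
proof -
  define g where "g = grad F p"
  have p\<Omega>: "p \<in> \<Omega>" and Fp: "F p = r" using p by (auto simp: mem_level_set)
  have "g \<noteq> 0" using grad_nonzero p\<Omega> by (simp add: g_def)
  define w where "w = g /\<^sub>R (g \<bullet> g)"
  have gw: "g \<bullet> w = 1" using \<open>g \<noteq> 0\<close> by (simp add: w_def)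
  define \<Phi> where "\<Phi> x = x + (F x - r - g \<bullet> (x - p)) *\<^sub>R w" for x
  define \<Phi>' where "\<Phi>' x = id_blinfun + (blinfun_scaleR_left w o\<^sub>L blinfun_inner_right (grad F x - g))" for x
  have \<Phi>': "blinfun_apply (\<Phi>' x) u = u + ((grad F x - g) \<bullet> u) *\<^sub>R w" for x u
    by (simp add: \<Phi>'_def blinfun.add_left)
  have der: "(\<Phi> has_derivative blinfun_apply (\<Phi>' x)) (at x)" if "x \<in> \<Omega>" for x
    unfolding \<Phi>_def
    by (auto intro!: derivative_eq_intros F_has_derivative[OF that] simp: \<Phi>' fun_eq_iff inner_diff_left)
  have cont: "continuous_on \<Omega> \<Phi>'"
    unfolding \<Phi>'_def by (intro continuous_intros continuous_on_gradF)
  have inv: "id_blinfun o\<^sub>L \<Phi>' p = id_blinfun"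
    by (rule blinfun_eqI) (simp add: \<Phi>' g_def)
  obtain U' V \<psi> \<psi>' where UV: "open U'" "U' \<subseteq> \<Omega>" "p \<in> U'" "open V" "\<Phi> p \<in> V" "homeomorphism U' V \<Phi> \<psi>"
    and \<psi>': "\<And>y. y \<in> V \<Longrightarrow> (\<psi> has_derivative (\<psi>' y)) (at y)"
    and inv_\<psi>': "\<And>y. y \<in> V \<Longrightarrow> \<psi>' y = inv (blinfun_apply (\<Phi>' (\<psi> y)))"
    and bij: "\<And>y. y \<in> V \<Longrightarrow> bij (blinfun_apply (\<Phi>' (\<psi> y)))"
    using inverse_function_theorem[OF open_\<Omega> der cont p\<Omega> inv] by blast
  have \<Phi>p: "\<Phi> p = p" using Fp by (simp add: \<Phi>_def)
  have "open ((\<lambda>t::real. p + t *\<^sub>R v) -` V)"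
    by (intro open_vimage UV continuous_intros)
  moreover have "0 \<in> (\<lambda>t::real. p + t *\<^sub>R v) -` V" using UV \<Phi>p by simp
  ultimately obtain \<epsilon> where \<epsilon>: "0 < \<epsilon>" "ball 0 \<epsilon> \<subseteq> (\<lambda>t. p + t *\<^sub>R v) -` V"
    using openE by blast
  define \<gamma> where "\<gamma> t = \<psi> (p + t *\<^sub>R v)" for t
  have inV: "p + t *\<^sub>R v \<in> V" if "t \<in> {-\<epsilon><..<\<epsilon>}" for t
    using \<epsilon>(2) that by (auto simp: subset_iff dist_real_def)
  have \<gamma>\<Omega>: "\<gamma> t \<in> \<Omega>" and \<Phi>\<gamma>: "\<Phi> (\<gamma> t) = p + t *\<^sub>R v" if "t \<in> {-\<epsilon><..<\<epsilon>}" for t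
    using UV(2,6) inV[OF that] unfolding \<gamma>_def homeomorphism_def by (blast, metis)
  \<comment> \<open>Since g \<bullet> w = 1, pairing with g gives g \<bullet> \<Phi> x = g \<bullet>
    p + F x - r, while g \<bullet> (p + t v) = g \<bullet> p.\<close>
  have F\<gamma>: "F (\<gamma> t) = r" if "t \<in> {-\<epsilon><..<\<epsilon>}" for t
    using arg_cong[OF \<Phi>\<gamma>[OF that], of "\<lambda>x. g \<bullet> x"] v gw
    by (simp add: \<Phi>_def g_def inner_add_right inner_diff_right)
  \<comment> \<open>Otherwise the differential of \<Phi> would send w to w - w = 0, against its
    injectivity.\<close>
  have nonchar: "grad F (\<gamma> t) \<bullet> w \<noteq> 0" if "t \<in> {-\<epsilon><..<\<epsilon>}" for t
  proof
    assume "grad F (\<gamma> t) \<bullet> w = 0"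
    then have "blinfun_apply (\<Phi>' (\<gamma> t)) w = blinfun_apply (\<Phi>' (\<gamma> t)) 0"
      using gw by (simp add: \<Phi>' inner_diff_left)
    then have "w = 0"
      using bij[OF inV[OF that]] by (metis \<gamma>_def bij_is_inj injD)
    with gw show False by simp
  qed
  have d\<gamma>: "(\<gamma> has_vector_derivative ker_proj w v (\<gamma> t)) (at t)" if t: "t \<in> {-\<epsilon><..<\<epsilon>}" for t
  proof -
    have "g \<bullet> ker_proj w v (\<gamma> t) = - ((grad F (\<gamma> t) \<bullet> v) / (grad F (\<gamma> t) \<bullet> w))"
      using v gw by (simp add: ker_proj_def g_def inner_diff_right)
    then have "blinfun_apply (\<Phi>' (\<gamma> t)) (ker_proj w v (\<gamma> t)) = v"
      using grad_ker_proj[OF nonchar[OF t]] by (simp add: \<Phi>' inner_diff_left) (simp add: ker_proj_def)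
    then have "\<psi>' (p + t *\<^sub>R v) v = ker_proj w v (\<gamma> t)"
      using inv_\<psi>'[OF inV[OF t]] bij[OF inV[OF t]] by (metis \<gamma>_def bij_is_inj inv_f_f)
    moreover have "(\<gamma> has_derivative (\<lambda>h. \<psi>' (p + t *\<^sub>R v) (h *\<^sub>R v))) (at t)"
      unfolding \<gamma>_def
      by (rule has_derivative_compose[where f = "\<lambda>t. p + t *\<^sub>R v" and g = \<psi>])
        (auto intro!: derivative_eq_intros \<psi>'[OF inV[OF t]])
    ultimately show ?thesis
      using linear_scale[OF has_derivative_linear[OF \<psi>'[OF inV[OF t]]]]
      by (simp add: has_vector_derivative_def)
  qed
  have \<gamma>0: "\<gamma> 0 = p" using UV \<Phi>p by (metis \<gamma>_def add.right_neutral homeomorphism_apply1 scaleR_zero_left)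
  have "smooth_on {-\<epsilon><..<\<epsilon>} \<gamma>"
    by (rule smooth_on_integral_curve[OF _ open_noncharacteristic _ smooth_on_ker_proj d\<gamma>])
      (use \<gamma>\<Omega> nonchar in auto)
  moreover have "\<gamma> ` {-\<epsilon><..<\<epsilon>} \<subseteq> \<Sigma>" using \<gamma>\<Omega> F\<gamma> by (auto simp: mem_level_set)
  moreover have "(\<gamma> has_vector_derivative v) (at 0)"
    using d\<gamma>[of 0] \<epsilon>(1) v by (simp add: \<gamma>0 ker_proj_def)
  ultimately show ?thesis
    using \<epsilon>(1) \<gamma>0 unfolding tangent_space_def by blast
qed

text \<open>Along a curve in \<Sigma> with velocity v both candidates compute the derivative of a
  function of one real parameter, which is unique. This pins down the choice hidden in
  \<open>frechet_derivative\<close> within \<Sigma>.\<close>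

lemma derivative_within_unique:
  fixes f :: "real ^ 'm option \<Rightarrow> 'b::real_normed_vector"
  assumes "v \<in> tangent_space \<Sigma> p"
    and L1: "(f has_derivative L1) (at p within \<Sigma>)" and L2: "(f has_derivative L2) (at p within \<Sigma>)"
  shows "L1 v = L2 v"
proof -
  obtain \<gamma> \<epsilon> where \<epsilon>: "0 < \<epsilon>" and \<gamma>: "\<gamma> ` {-\<epsilon><..<\<epsilon>} \<subseteq> \<Sigma>" "\<gamma> (0::real) = p" "(\<gamma> has_vector_derivative v) (at 0)"
    using assms(1) unfolding tangent_space_def by blast
  have "((\<lambda>t. f (\<gamma> t)) has_vector_derivative L v) (at 0)" if L: "(f has_derivative L) (at p within \<Sigma>)" for L
  proof -
    have "(\<gamma> has_derivative (\<lambda>h. h *\<^sub>R v)) (at 0 within {-\<epsilon><..<\<epsilon>})"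
      using \<gamma>(3) by (auto simp: has_vector_derivative_def intro: has_derivative_at_withinI)
    from has_derivative_in_compose[OF this, of f L]
    have "((\<lambda>t. f (\<gamma> t)) has_derivative (\<lambda>h. L (h *\<^sub>R v))) (at 0 within {-\<epsilon><..<\<epsilon>})"
      using L \<gamma> by (auto intro: has_derivative_subset)
    then show ?thesis
      using \<epsilon> linear_scale[OF has_derivative_linear[OF L]]
      by (simp add: has_vector_derivative_def at_within_open[of 0 "{-\<epsilon><..<\<epsilon>}"])
  qed
  from vector_derivative_unique_at[OF this[OF L1] this[OF L2]] show ?thesis .
qed

lemma flat_deriv_eq:
  assumes "v \<in> tangent_space \<Sigma> p" "(f has_derivative L) (at p within \<Sigma>)"
  shows "flat_deriv \<Sigma> f p v = L v"
  unfolding flat_deriv_def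
  by (rule derivative_within_unique[OF assms(1) _ assms(2)])
    (use assms(2) in \<open>auto simp: frechet_derivative_works[symmetric] differentiable_def\<close>)

text \<open>F is constant on \<Sigma>, so dF and the zero map are both derivatives of F within
  \<Sigma> and agree on tangent vectors. The reverse inclusion is the curve construction.\<close>

lemma tangent_space_eq:
  assumes "p \<in> \<Sigma>"
  shows "tangent_space \<Sigma> p = {v. grad F p \<bullet> v = 0}"
proof -
  have "grad F p \<bullet> v = 0" if "v \<in> tangent_space \<Sigma> p" for v
  proof (rule derivative_within_unique[OF that])
    show "(F has_derivative (\<lambda>v. grad F p \<bullet> v)) (at p within \<Sigma>)"
      using F_has_derivative assms by (auto simp: mem_level_set intro: has_derivative_at_withinI)
    show "(F has_derivative (\<lambda>v. 0)) (at p within \<Sigma>)"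
      by (rule has_derivative_transform_within[OF has_derivative_const[of r] zero_less_one assms])
        (simp add: mem_level_set)
  qed
  then show ?thesis using kernel_subset_tangent_space[OF assms] by auto
qed

lemma openin_level_set: "openin (top_of_set \<Sigma>) \<Sigma>"
  by simp

lemma smooth_along_has_derivative:
  fixes Y :: "real ^ 'm option \<Rightarrow> 'b::real_normed_vector"
  assumes "openin (top_of_set \<Sigma>) V" "smooth_along V Y" "p \<in> V"
  obtains L where "(Y has_derivative L) (at p within \<Sigma>)"
proof -
  obtain O' g where O': "open O'" "p \<in> O'" "smooth_on O' g" "\<And>x. x \<in> V \<inter> O' \<Longrightarrow> Y x = g x"
    using assms(2,3) unfolding smooth_along_def by metis
  have "(g has_derivative frechet_derivative g (at p)) (at p within \<Sigma>)"
    using smooth_on_has_derivative[OF O'(3,2)] by (rule has_derivative_at_withinI)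
  moreover have "openin (top_of_set \<Sigma>) (V \<inter> O')"
    using assms(1) O'(1) by (simp add: openin_Int_open)
  ultimately have "(Y has_derivative frechet_derivative g (at p)) (at p within \<Sigma>)"
    using has_derivative_transform_openin[of \<Sigma> "V \<inter> O'" p g _ Y] O' assms(3) by auto
  then show ?thesis by (rule that)
qed

lemma smooth_on_imp_smooth_along:
  assumes "open S" "V \<subseteq> S" "smooth_on S g"
  shows "smooth_along V g"
  unfolding smooth_along_def using assms by blast

section \<open>Tensors and densities induced by a transversal\<close>

lemma transversal_coeff_eq:
  assumes "p \<in> \<Sigma>" "grad F p \<bullet> T p \<noteq> 0"
  shows "transversal_coeff \<Sigma> T p w = (grad F p \<bullet> w) / (grad F p \<bullet> T p)"
  unfolding transversal_coeff_def tangent_space_eq[OF assms(1)]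
  by (rule the_equality) (use assms(2) in \<open>auto simp: inner_diff_right field_simps\<close>)

text \<open>The product rule with the symmetry of the Hessian. For tangent Y, where the left side is
  0, it yields h; for a transversal it ties the parallel condition to the Hessian.\<close>

lemma grad_inner_field_deriv:
  assumes p: "p \<in> \<Sigma>" and u: "u \<in> tangent_space \<Sigma> p" and L: "(Y has_derivative L) (at p within \<Sigma>)"
  shows "flat_deriv \<Sigma> (\<lambda>x. grad F x \<bullet> Y x) p u = u \<bullet> (hess F p *v Y p) + grad F p \<bullet> flat_deriv \<Sigma> Y p u"
proof -
  have p\<Omega>: "p \<in> \<Omega>" using p by (simp add: mem_level_set)
  have "((\<lambda>x. grad F x \<bullet> Y x) has_derivative (\<lambda>h. grad F p \<bullet> L h + (hess F p *v h) \<bullet> Y p)) (at p within \<Sigma>)"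
    by (rule has_derivative_inner[OF has_derivative_at_withinI[OF gradF_has_derivative[OF p\<Omega>]] L])
  from flat_deriv_eq[OF u this] show ?thesis
    using inner_matrix_vector_symmetric[OF hess_sym[OF p\<Omega>], of u "Y p"]
    by (simp add: flat_deriv_eq[OF u L] inner_commute)
qed

lemma tangent_field_deriv:
  assumes V: "openin (top_of_set \<Sigma>) V" "p \<in> V" and Y: "tangent_field \<Sigma> V Y" and u: "u \<in> tangent_space \<Sigma> p"
  shows "grad F p \<bullet> flat_deriv \<Sigma> Y p u = - (u \<bullet> (hess F p *v Y p))"
proof -
  have V\<Sigma>: "V \<subseteq> \<Sigma>" using V(1) by (rule openin_imp_subset)
  obtain L where L: "(Y has_derivative L) (at p within \<Sigma>)"
    using smooth_along_has_derivative[OF V(1) _ V(2)] Y by (auto simp: tangent_field_def)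
  have "((\<lambda>x. grad F x \<bullet> Y x) has_derivative (\<lambda>h. 0)) (at p within \<Sigma>)"
    by (rule has_derivative_transform_openin[OF V has_derivative_const[of 0]])
      (use Y V\<Sigma> tangent_space_eq in \<open>auto simp: tangent_field_def\<close>)
  from flat_deriv_eq[OF u this] grad_inner_field_deriv[OF _ u L] V V\<Sigma> show ?thesis by auto
qed

lemma tangent_field_ker_proj:
  "tangent_field \<Sigma> {x \<in> \<Sigma>. grad F x \<bullet> w \<noteq> 0} (ker_proj w v)"
  unfolding tangent_field_def
proof
  show "smooth_along {x \<in> \<Sigma>. grad F x \<bullet> w \<noteq> 0} (ker_proj w v)"
    by (rule smooth_on_imp_smooth_along[OF open_noncharacteristic _ smooth_on_ker_proj])
      (auto simp: mem_level_set)
qed (auto simp: tangent_space_eq grad_ker_proj)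

lemma openin_noncharacteristic: "openin (top_of_set \<Sigma>) {x \<in> \<Sigma>. grad F x \<bullet> w \<noteq> 0}"
proof -
  have "{x \<in> \<Sigma>. grad F x \<bullet> w \<noteq> 0} = \<Sigma> \<inter> {x \<in> \<Omega>. grad F x \<bullet> w \<noteq> 0}"
    by (auto simp: level_set_def)
  then show ?thesis using openin_open_Int[OF open_noncharacteristic] by simp
qed

lemma second_fundamental_form_eq:
  assumes p: "p \<in> \<Sigma>" and T: "grad F p \<bullet> T p \<noteq> 0"
    and u: "u \<in> tangent_space \<Sigma> p" and v: "v \<in> tangent_space \<Sigma> p"
  shows "second_fundamental_form \<Sigma> T p u v = - inverse (grad F p \<bullet> T p) * (u \<bullet> (hess F p *v v))"
  unfolding second_fundamental_form_def
proof (rule the_equality)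
  show *: "\<forall>V Y. openin (top_of_set \<Sigma>) V \<longrightarrow> p \<in> V \<longrightarrow> tangent_field \<Sigma> V Y \<longrightarrow> Y p = v \<longrightarrow>
      transversal_coeff \<Sigma> T p (flat_deriv \<Sigma> Y p u) = - inverse (grad F p \<bullet> T p) * (u \<bullet> (hess F p *v v))"
    using tangent_field_deriv[OF _ _ _ u] by (auto simp: transversal_coeff_eq[of p T, OF p T] divide_inverse)
  fix c
  assume c: "\<forall>V Y. openin (top_of_set \<Sigma>) V \<longrightarrow> p \<in> V \<longrightarrow> tangent_field \<Sigma> V Y \<longrightarrow> Y p = v \<longrightarrow>
      transversal_coeff \<Sigma> T p (flat_deriv \<Sigma> Y p u) = c"
  \<comment> \<open>Uniqueness of the described value requires at least one tangent field through v.
    With this w the projection is defined near p and fixes v at p.\<close>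
  let ?w = "grad F p"
  have "p \<in> {x \<in> \<Sigma>. grad F x \<bullet> ?w \<noteq> 0}"
    using p grad_nonzero by (simp add: mem_level_set)
  moreover have "ker_proj ?w v p = v"
    using v p by (simp add: ker_proj_def tangent_space_eq)
  ultimately show "c = - inverse (grad F p \<bullet> T p) * (u \<bullet> (hess F p *v v))"
    using c[rule_format, OF openin_noncharacteristic _ tangent_field_ker_proj, of ?w v]
      *[rule_format, OF openin_noncharacteristic _ tangent_field_ker_proj, of ?w v] by simp
qed

lemma transversal_iff:
  "transversal \<Sigma> T \<longleftrightarrow> smooth_along \<Sigma> T \<and> (\<forall>p\<in>\<Sigma>. grad F p \<bullet> T p \<noteq> 0)"
  by (auto simp: transversal_def tangent_space_eq)

lemma hypersurface_level_set: "hypersurface \<Sigma>"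
  unfolding hypersurface_def
proof
  fix p assume "p \<in> \<Sigma>"
  have "frechet_derivative (\<lambda>x. F x - r) (at x) \<noteq> (\<lambda>_. 0)" if "x \<in> \<Omega>" for x
  proof -
    have "((\<lambda>x. F x - r) has_derivative (\<lambda>v. grad F x \<bullet> v)) (at x)"
      using F_has_derivative[OF that] by (auto intro!: derivative_eq_intros)
    from frechet_derivative_at[OF this] grad_nonzero[OF that] show ?thesis
      by (metis inner_eq_zero_iff)
  qed
  moreover have "smooth_on \<Omega> (\<lambda>x. F x - r)"
    by (intro smooth_on_diff smooth_on_const open_\<Omega> smooth_F)
  ultimately show "\<exists>V (f :: real ^ 'm option \<Rightarrow> real). open V \<and> p \<in> V \<and> smooth_on V f \<and>
      (\<forall>x\<in>V. frechet_derivative f (at x) \<noteq> (\<lambda>_. 0)) \<and> \<Sigma> \<inter> V = {x \<in> V. f x = 0}"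
    using open_\<Omega> \<open>p \<in> \<Sigma>\<close> by (intro exI[of _ \<Omega>] exI[of _ "\<lambda>x. F x - r"]) (auto simp: level_set_def)
qed

text \<open>\<open>Psi\<close> is parallel for the flat connection, so differentiating it on T, Y_1,
  ..., Y_n only differentiates the vectors. Expanding their derivatives in that same frame leaves
  the trace of the coefficients, \<tau>(u) + tr A with \<tau>(u) = (g \<bullet> D_u T) / (g
  \<bullet> T); the transversal parts of the D_u Y_i are off the diagonal. So the covariant
  derivative of the density is \<tau>(u) times the density.\<close>

lemma covariant_derivative_interior_density:
  fixes Y :: "'m \<Rightarrow> real ^ 'm option \<Rightarrow> real ^ 'm option"
  assumes T: "transversal \<Sigma> T" and V: "openin (top_of_set \<Sigma>) V" "p \<in> V"
    and Y: "\<And>i. tangent_field \<Sigma> V (Y i)"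
    and frame: "inj (\<lambda>i. Y i p)" "independent (range (\<lambda>i. Y i p))"
    and u: "u \<in> tangent_space \<Sigma> p"
    and A: "\<And>i. induced_connection \<Sigma> T p u (Y i) = (\<Sum>j\<in>UNIV. (A $ i $ j) *\<^sub>R Y j p)"
  shows "flat_deriv \<Sigma> (\<lambda>x. interior_density T x (\<lambda>i. Y i x)) p u
           - trace A * interior_density T p (\<lambda>i. Y i p)
         = (grad F p \<bullet> flat_deriv \<Sigma> T p u) / (grad F p \<bullet> T p) * interior_density T p (\<lambda>i. Y i p)"
    and "interior_density T p (\<lambda>i. Y i p) \<noteq> 0"
proof -
  let ?f = "\<lambda>x k. case_option (T x) (\<lambda>i. Y i x) k"
  have p: "p \<in> \<Sigma>" using openin_imp_subset[OF V(1)] V(2) by blast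
  have gT: "grad F p \<bullet> T p \<noteq> 0" using T p transversal_iff by blast
  have gY: "grad F p \<bullet> Y i p = 0" for i
    using Y[of i] V(2) p by (auto simp: tangent_field_def tangent_space_eq)
  have nz: "Psi (?f p) \<noteq> 0"
    by (rule Psi_nonzero_if_independent[OF frame gY gT])
  then show "interior_density T p (\<lambda>i. Y i p) \<noteq> 0" by (simp add: interior_density_def)
  obtain L0 where L0: "(T has_derivative L0) (at p within \<Sigma>)"
    using smooth_along_has_derivative[OF openin_level_set _ p] T by (auto simp: transversal_def)
  have "\<exists>L. (Y i has_derivative L) (at p within \<Sigma>)" for i
    using smooth_along_has_derivative[OF V(1) _ V(2), of "Y i"] Y[of i] by (auto simp: tangent_field_def)
  then obtain L where L: "\<And>i. (Y i has_derivative L i) (at p within \<Sigma>)" by metis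
  let ?f' = "case_option L0 L"
  have "((\<lambda>x. ?f x k) has_derivative ?f' k) (at p within \<Sigma>)" for k
    using L0 L by (cases k) auto
  from det_has_derivative[OF this]
  have dPsi: "((\<lambda>x. Psi (?f x)) has_derivative (\<lambda>h. \<Sum>k\<in>UNIV. det (\<chi> l. if l = k then ?f' k h else ?f p l))) (at p within \<Sigma>)"
    by (simp add: Psi_def)
  obtain c where c: "flat_deriv \<Sigma> T p u = (\<Sum>k\<in>UNIV. c k *\<^sub>R ?f p k)"
    using Psi_nonzero_imp_combination[OF nz] by blast
  have cNone: "c None = (grad F p \<bullet> flat_deriv \<Sigma> T p u) / (grad F p \<bullet> T p)"
    using gT gY unfolding c by (simp add: UNIV_option_conv sum.reindex inner_add_right inner_sum_right)
  \<comment> \<open>the coefficients of the derivatives of \<open>T, Y\<^sub>1, \<dots>, Y\<^sub>n\<close> along \<open>u\<close> in the frame \<open>T, Y\<^sub>1, \<dots>, Y\<^sub>n\<close> itself\<close>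
  define C where "C k = case_option c (\<lambda>i. case_option (transversal_coeff \<Sigma> T p (flat_deriv \<Sigma> (Y i) p u)) (\<lambda>j. A $ i $ j)) k" for k
  have f'u: "?f' k u = (\<Sum>l\<in>UNIV. C k l *\<^sub>R ?f p l)" for k
  proof (cases k)
    case None
    then show ?thesis using flat_deriv_eq[OF u L0] c by (simp add: C_def)
  next
    case (Some i)
    have "L i u = transversal_coeff \<Sigma> T p (flat_deriv \<Sigma> (Y i) p u) *\<^sub>R T p + (\<Sum>j\<in>UNIV. (A $ i $ j) *\<^sub>R Y j p)"
      using A[of i] flat_deriv_eq[OF u L] by (simp add: induced_connection_def algebra_simps)
    then show ?thesis using Some by (simp add: C_def UNIV_option_conv sum.reindex)
  qed
  have "(\<Sum>k\<in>UNIV. det (\<chi> l. if l = k then ?f' k u else ?f p l)) = (\<Sum>k\<in>UNIV. C k k) * Psi (?f p)"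
    unfolding f'u det_replace_row_combination Psi_def sum_distrib_right ..
  also have "(\<Sum>k\<in>UNIV. C k k) = c None + trace A"
    by (simp add: UNIV_option_conv sum.reindex C_def trace_def)
  finally have sum: "(\<Sum>k\<in>UNIV. det (\<chi> l. if l = k then ?f' k u else ?f p l)) = (c None + trace A) * Psi (?f p)" .
  \<comment> \<open>The frame condition makes \<open>Psi\<close> nonzero at p, so its absolute
    value, taken as a norm, is differentiable there.\<close>
  have "((\<lambda>x. norm (Psi (?f x))) has_derivative
      (\<lambda>h. (\<Sum>k\<in>UNIV. det (\<chi> l. if l = k then ?f' k h else ?f p l)) \<bullet> sgn (Psi (?f p)))) (at p within \<Sigma>)"
    by (rule has_derivative_compose[OF dPsi has_derivative_norm[OF nz]])
  then have "((\<lambda>x. interior_density T x (\<lambda>i. Y i x)) has_derivative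
      (\<lambda>h. (\<Sum>k\<in>UNIV. det (\<chi> l. if l = k then ?f' k h else ?f p l)) \<bullet> sgn (Psi (?f p)))) (at p within \<Sigma>)"
    by (simp add: interior_density_def)
  from flat_deriv_eq[OF u this]
  show "flat_deriv \<Sigma> (\<lambda>x. interior_density T x (\<lambda>i. Y i x)) p u
           - trace A * interior_density T p (\<lambda>i. Y i p)
         = (grad F p \<bullet> flat_deriv \<Sigma> T p u) / (grad F p \<bullet> T p) * interior_density T p (\<lambda>i. Y i p)"
    unfolding sum cNone[symmetric] interior_density_def
    by (simp add: algebra_simps abs_sgn[of "Psi _"])
qed

text \<open>The covariant derivative is \<tau>(u) times a nonzero number. To extract \<tau>(u) = 0
  from parallelism, a tangent frame around each point must be exhibited, since the definition
  quantifies over frames.\<close>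

lemma parallel_density_iff:
  assumes T: "transversal \<Sigma> T"
  shows "parallel_density \<Sigma> T (interior_density T) \<longleftrightarrow>
    (\<forall>p\<in>\<Sigma>. \<forall>u\<in>tangent_space \<Sigma> p. grad F p \<bullet> flat_deriv \<Sigma> T p u = 0)"
proof
  assume R: "\<forall>p\<in>\<Sigma>. \<forall>u\<in>tangent_space \<Sigma> p. grad F p \<bullet> flat_deriv \<Sigma> T p u = 0"
  show "parallel_density \<Sigma> T (interior_density T)"
    unfolding parallel_density_def
  proof (intro allI impI ballI)
    fix V p u and Y :: "'m \<Rightarrow> real ^ 'm option \<Rightarrow> real ^ 'm option" and A :: "real ^ 'm ^ 'm"
    assume *: "openin (top_of_set \<Sigma>) V" "\<forall>i. tangent_field \<Sigma> V (Y i)"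
      "\<forall>x\<in>V. inj (\<lambda>i. Y i x) \<and> independent (range (\<lambda>i. Y i x))" "p \<in> V" "u \<in> tangent_space \<Sigma> p"
      "\<forall>i. induced_connection \<Sigma> T p u (Y i) = (\<Sum>j\<in>UNIV. (A $ i $ j) *\<^sub>R Y j p)"
    have "p \<in> \<Sigma>" using * openin_imp_subset by blast
    with R * covariant_derivative_interior_density(1)[OF T, of V p Y u A]
    show "flat_deriv \<Sigma> (\<lambda>x. interior_density T x (\<lambda>i. Y i x)) p u
        - trace A * interior_density T p (\<lambda>i. Y i p) = 0" by simp
  qed
next
  assume P: "parallel_density \<Sigma> T (interior_density T)"
  show "\<forall>p\<in>\<Sigma>. \<forall>u\<in>tangent_space \<Sigma> p. grad F p \<bullet> flat_deriv \<Sigma> T p u = 0"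
  proof (intro ballI)
    fix p u assume p: "p \<in> \<Sigma>" and u: "u \<in> tangent_space \<Sigma> p"
    define w where "w = grad F p"
    define V where "V = {x \<in> \<Sigma>. grad F x \<bullet> w \<noteq> 0}"
    have wp: "grad F p \<bullet> w \<noteq> 0" using p grad_nonzero by (simp add: w_def mem_level_set)
    then have pV: "p \<in> V" using p by (simp add: V_def)
    obtain v :: "'m \<Rightarrow> real ^ 'm option" where v: "\<And>w'. w \<bullet> w' \<noteq> 0 \<Longrightarrow> Psi (case_option w' v) \<noteq> 0"
      using exists_orthogonal_frame[of w] wp by (metis inner_zero_right)
    let ?Y = "\<lambda>i. ker_proj w (v i)"
    have Y: "tangent_field \<Sigma> V (?Y i)" for i
      unfolding V_def by (rule tangent_field_ker_proj)
    have V: "openin (top_of_set \<Sigma>) V" unfolding V_def by (rule openin_noncharacteristic)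
    have frame: "inj (\<lambda>i. ?Y i x) \<and> independent (range (\<lambda>i. ?Y i x))" if "x \<in> V" for x
    proof -
      \<comment> \<open>Projecting along w subtracts multiples of the row w from the other rows. So
        the constant vectors \<open>v i\<close>, which complete w to a basis, project to a frame at
        every point of V.\<close>
      have "Psi (case_option w (\<lambda>i. ?Y i x)) = Psi (case_option w v)"
      proof -
        have "Psi (case_option w (\<lambda>i. ?Y i x)) =
            det (\<chi> l. if l = None then w else if l \<in> range Some then
              case_option w v l + (- ((grad F x \<bullet> case_option w v l) / (grad F x \<bullet> w))) *s w else case_option w v l)"
          unfolding Psi_def
          by (rule arg_cong[of _ _ det]) (auto simp: vec_eq_iff ker_proj_def split: option.split)
        also have "\<dots> = det (\<chi> l. if l = None then w else case_option w v l)"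
          by (rule det_add_row_multiples) auto
        also have "\<dots> = Psi (case_option w v)"
          unfolding Psi_def by (rule arg_cong[of _ _ det]) (auto simp: vec_eq_iff)
        finally show ?thesis .
      qed
      then show ?thesis
        using v[of w] wp independent_if_Psi_nonzero[of w "\<lambda>i. ?Y i x"] by (simp add: w_def)
    qed
    have gT: "grad F p \<bullet> T p \<noteq> 0" using T p transversal_iff by blast
    have gY: "grad F p \<bullet> ?Y i p = 0" for i by (rule grad_ker_proj[OF wp])
    have nz: "Psi (case_option (T p) (\<lambda>i. ?Y i p)) \<noteq> 0"
      by (rule Psi_nonzero_if_independent[where Y = "\<lambda>i. ?Y i p", OF _ _ gY gT]) (use frame[OF pV] in auto)
    have "\<exists>a. induced_connection \<Sigma> T p u (?Y i) = (\<Sum>j\<in>UNIV. a j *\<^sub>R ?Y j p)" for i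
    proof -
      obtain c where c: "induced_connection \<Sigma> T p u (?Y i) = (\<Sum>k\<in>UNIV. c k *\<^sub>R case_option (T p) (\<lambda>i. ?Y i p) k)"
        using Psi_nonzero_imp_combination[OF nz] by blast
      \<comment> \<open>The induced connection has no transversal part, so the coefficient of
        \<open>T p\<close> vanishes and a matrix A as in the definition exists.\<close>
      have "grad F p \<bullet> induced_connection \<Sigma> T p u (?Y i) = 0"
        using gT by (simp add: induced_connection_def transversal_coeff_eq[of p T, OF p gT] inner_diff_right)
      then have "c None = 0"
        using gT gY unfolding c by (simp add: UNIV_option_conv sum.reindex inner_add_right inner_sum_right)
      then show ?thesis
        using c by (intro exI[of _ "\<lambda>j. c (Some j)"]) (simp add: UNIV_option_conv sum.reindex)
    qed
    then obtain a where a: "\<And>i. induced_connection \<Sigma> T p u (?Y i) = (\<Sum>j\<in>UNIV. a i j *\<^sub>R ?Y j p)" by metis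
    let ?A = "\<chi> i j. a i j"
    have A: "induced_connection \<Sigma> T p u (?Y i) = (\<Sum>j\<in>UNIV. (?A $ i $ j) *\<^sub>R ?Y j p)" for i
      using a by simp
    have "flat_deriv \<Sigma> (\<lambda>x. interior_density T x (\<lambda>i. ?Y i x)) p u
        - trace ?A * interior_density T p (\<lambda>i. ?Y i p) = 0"
      using P[unfolded parallel_density_def, rule_format, OF V Y frame pV u A] .
    with covariant_derivative_interior_density[OF T V pV Y _ _ u A] frame[OF pV] gT
    show "grad F p \<bullet> flat_deriv \<Sigma> T p u = 0" by simp
  qed
qed

end

section \<open>The equiaffine normal\<close>

lemma N_field_eq: "N_field F x = adjugate (hess F x) *v grad F x"
  by (simp add: N_field_def matrix_vector_mult_def)

lemma U_fun_eq: "U_fun F x = grad F x \<bullet> N_field F x"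
  by (simp add: U_fun_def N_field_def inner_vec_def sum_distrib_left mult_ac)

section \<open>Linear algebra at a point where U(F) does not vanish\<close>

locale symmetric_point =
  fixes F :: "real ^ 'm::finite option \<Rightarrow> real" and q :: "real ^ 'm option \<Rightarrow> real" and x
  assumes hess_sym: "transpose (hess F x) = hess F x" and U_nonzero: "U_fun F x \<noteq> 0"
    and q_nonzero: "q x \<noteq> 0"
begin

abbreviation "g \<equiv> grad F x"
abbreviation "H \<equiv> hess F x"
abbreviation "N \<equiv> N_field F x"
abbreviation "U \<equiv> U_fun F x"
abbreviation "M \<equiv> m_tensor F q x"

lemma m_tensor_eq: "M = (\<chi> i j. H $ i $ j + g $ i * (((q x - det H) / U) *\<^sub>R g) $ j)"
  by (simp add: m_tensor_def Pi_lower_def hess_det_def vec_eq_iff divide_inverse algebra_simps)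

lemma hess_N: "H *v N = det H *\<^sub>R g"
proof -
  have "H *v N = mat (det H) *v g"
    by (simp add: N_field_eq matrix_vector_mul_assoc mult_adjugate)
  also have "\<dots> = det H *\<^sub>R g"
    by (simp add: matrix_vector_mult_def mat_def vec_eq_iff if_distrib[of "\<lambda>y. y * _"] cong: if_cong)
  finally show ?thesis .
qed

text \<open>As g \<bullet> adj(H) g = U, the rank-one term contributes exactly q - det H.\<close>

lemma det_m_tensor: "det M = q x"
  unfolding m_tensor_eq matrix_determinant_lemma
  using U_nonzero by (simp add: N_field_eq[symmetric] U_fun_eq[symmetric])

lemma m_tensor_vector: "M *v y = H *v y + ((q x - det H) / U * (g \<bullet> y)) *\<^sub>R g"
  by (simp add: m_tensor_eq vec_eq_iff matrix_vector_mult_def inner_vec_def sum.distrib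
      sum_distrib_left sum_divide_distrib distrib_left distrib_right mult_ac)

lemma m_tensor_N: "M *v N = q x *\<^sub>R g"
  using U_nonzero by (simp add: m_tensor_vector hess_N U_fun_eq[symmetric] scaleR_left_distrib[symmetric])

lemma m_tensor_sym: "transpose M = M"
proof -
  have "H $ j $ i = H $ i $ j" for i j
    using arg_cong[OF hess_sym, of "\<lambda>A. A $ i $ j"] by (simp add: transpose_def)
  then show ?thesis by (simp add: m_tensor_eq vec_eq_iff transpose_def mult_ac)
qed

text \<open>The Hessian may be singular; on tangent vectors it agrees with the tensor \<open>m\<close>, whose determinant is \<open>q\<close>.\<close>

lemma Psi_N_square:
  assumes "\<And>i. g \<bullet> Y i = 0"
  shows "(Psi (case_option N Y))\<^sup>2 = U * det (\<chi> i j. Y i \<bullet> (H *v Y j))"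
  using Psi_square_eq[OF m_tensor_sym, of N g Y] assms m_tensor_N det_m_tensor q_nonzero
  by (simp add: m_tensor_vector U_fun_eq[symmetric])

text \<open>On y the tensors H and m agree, and m y is orthogonal to N as well, because m N = q g. N
  and the tangent vectors span, so m y = 0, and m is invertible.\<close>

lemma hess_nondegenerate:
  assumes y: "g \<bullet> y = 0" and 0: "\<And>u. g \<bullet> u = 0 \<Longrightarrow> u \<bullet> (H *v y) = 0"
  shows "y = 0"
proof -
  have My: "M *v y = H *v y" using y by (simp add: m_tensor_vector)
  have "u \<bullet> (M *v y) = 0" for u
  proof -
    have NM: "N \<bullet> (M *v y) = 0"
      using inner_matrix_vector_symmetric[OF m_tensor_sym, of N y] y by (simp add: m_tensor_N inner_commute)
    have "g \<bullet> (u - ((g \<bullet> u) / U) *\<^sub>R N) = 0"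
      using U_nonzero by (simp add: inner_diff_right U_fun_eq[symmetric])
    from 0[OF this] show ?thesis using NM by (simp add: My inner_diff_left)
  qed
  then have "M *v y = 0" by (metis inner_eq_zero_iff)
  moreover have "invertible M" using det_m_tensor q_nonzero by (simp add: invertible_det_nz)
  ultimately show ?thesis by (metis invertible_left_inverse matrix_left_invertible_ker)
qed

lemma Pi_upper_vector:
  "Pi_upper F q x *v y = matrix_inv M *v y - ((N \<bullet> y) / (q x * U)) *\<^sub>R N"
  by (simp add: Pi_upper_def vec_eq_iff matrix_vector_mult_def inner_vec_def sum_subtractf
      left_diff_distrib right_diff_distrib sum_distrib_left sum_distrib_right sum_divide_distrib divide_inverse mult_ac)

lemma m_tensor_inv: "M *v (matrix_inv M *v y) = y"
proof -
  have "M ** matrix_inv M = mat 1"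
    using mult_adjugate[of M] det_m_tensor q_nonzero
    by (simp add: matrix_inv_eq_adjugate vec_eq_iff matrix_matrix_mult_def mat_def mult.left_commute
        flip: sum_distrib_left)
  then show ?thesis by (simp add: matrix_vector_mul_assoc)
qed

text \<open>From m N = q g follows g \<bullet> m^(-1) y = (N \<bullet> y) / q; the subtracted N-term
  cancels exactly this, as g \<bullet> N = U.\<close>

lemma grad_Pi_upper: "g \<bullet> (Pi_upper F q x *v y) = 0"
proof -
  have "q x * (g \<bullet> (matrix_inv M *v y)) = (matrix_inv M *v y) \<bullet> (M *v N)"
    by (simp add: m_tensor_N inner_commute)
  also have "\<dots> = N \<bullet> y"
    using inner_matrix_vector_symmetric[OF m_tensor_sym, of "matrix_inv M *v y" N] by (simp add: m_tensor_inv)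
  finally have "g \<bullet> (matrix_inv M *v y) = (N \<bullet> y) / q x" using q_nonzero by (simp add: field_simps)
  then show ?thesis
    using U_nonzero by (simp add: Pi_upper_vector inner_diff_right U_fun_eq[symmetric])
qed

text \<open>On the tangent vector \<Pi> y the Hessian acts as m, and m \<Pi> y differs from y by a
  multiple of g, which u does not see. The auxiliary q drops out here.\<close>

lemma hess_Pi_upper:
  assumes "g \<bullet> u = 0"
  shows "u \<bullet> (H *v (Pi_upper F q x *v y)) = u \<bullet> y"
proof -
  have "H *v (Pi_upper F q x *v y) = M *v (Pi_upper F q x *v y)"
    by (simp add: m_tensor_vector grad_Pi_upper)
  also have "\<dots> = y - ((N \<bullet> y) / U) *\<^sub>R g"
    using q_nonzero
    by (simp add: Pi_upper_vector matrix_vector_mult_diff_distrib m_tensor_inv matrix_vector_mult_scaleR m_tensor_N)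
  finally show ?thesis using assms by (simp add: inner_diff_right inner_commute)
qed

end

section \<open>The candidate normal and its characterization\<close>

locale equiaffine_function =
  fixes \<Omega> :: "(real ^ 'm::finite option) set" and F q :: "real ^ 'm option \<Rightarrow> real" and r :: real
  assumes open_domain: "open \<Omega>" and smooth_function: "smooth_on \<Omega> F" and smooth_q: "smooth_on \<Omega> q"
    and U_nonzero: "x \<in> \<Omega> \<Longrightarrow> U_fun F x \<noteq> 0" and q_nonzero: "x \<in> \<Omega> \<Longrightarrow> q x \<noteq> 0"
begin

sublocale regular_function \<Omega> F r
proof
  show "grad F x \<noteq> 0" if "x \<in> \<Omega>" for x using U_nonzero[OF that] by (auto simp: U_fun_eq)
qed (rule open_domain smooth_function)+

lemma symmetric_point: "x \<in> \<Omega> \<Longrightarrow> symmetric_point F q x"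
  by unfold_locales (auto simp: hess_sym U_nonzero q_nonzero)

definition co_orientation where "co_orientation x = - sgn (U_fun F x) *\<^sub>R N_field F x"

definition affine_normal where
  "affine_normal x = (\<chi> i. - (\<bar>U_fun F x\<bar> powr (1 / (real CARD('m) + 2)) * inverse (U_fun F x) * N_field F x $ i)
                     - (\<Sum>p\<in>UNIV. k_tensor F q x $ i $ p * mu F x $ p))"

text \<open>The tensor k and the coefficient of N carry the same power of |U|, which factors
  out.\<close>

lemma affine_normal_eq:
  "affine_normal x
   = - (\<bar>U_fun F x\<bar> powr (1 / (real CARD('m) + 2))) *\<^sub>R (inverse (U_fun F x) *\<^sub>R N_field F x + Pi_upper F q x *v mu F x)"
  by (simp add: affine_normal_def k_tensor_def vec_eq_iff matrix_vector_mult_def sum_distrib_left algebra_simps)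

lemma grad_affine_normal:
  assumes "x \<in> \<Omega>"
  shows "grad F x \<bullet> affine_normal x = - (\<bar>U_fun F x\<bar> powr (1 / (real CARD('m) + 2)))"
proof -
  interpret symmetric_point F q x by (rule symmetric_point[OF assms])
  show ?thesis using U_nonzero
    by (simp add: affine_normal_eq inner_add_right grad_Pi_upper U_fun_eq[symmetric] )
qed

lemma hess_affine_normal:
  assumes "x \<in> \<Omega>" "grad F x \<bullet> u = 0"
  shows "u \<bullet> (hess F x *v affine_normal x) = - (\<bar>U_fun F x\<bar> powr (1 / (real CARD('m) + 2))) * (u \<bullet> mu F x)"
proof -
  interpret symmetric_point F q x by (rule symmetric_point[OF assms(1)])
  show ?thesis
    unfolding affine_normal_eq matrix_vector_mult_scaleR inner_scaleR_right matrix_vector_right_distrib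
      inner_add_right hess_Pi_upper[OF assms(2)] hess_N
    using assms(2) by (simp add: inner_commute[of u g])
qed

lemma smooth_on_mu: "smooth_on \<Omega> (mu F)"
  unfolding mu_def[abs_def]
  by (intro smooth_on_vec smooth_on_mult smooth_on_const smooth_on_partial_deriv smooth_on_ln_abs
      smooth_on_U_fun open_domain smooth_function U_nonzero)

lemma smooth_on_m_tensor: "smooth_on \<Omega> (\<lambda>x. m_tensor F q x $ i $ j)"
  unfolding m_tensor_def Pi_lower_def vec_lambda_beta hess_det_def
  by (intro smooth_on_add smooth_on_diff smooth_on_mult smooth_on_inverse smooth_on_U_fun smooth_on_det
      smooth_on_hess smooth_on_grad_nth open_domain smooth_function U_nonzero smooth_q)

text \<open>\<open>matrix_inv\<close> is a choice, so smoothness in x is read off from the adjugate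
  divided by the determinant, which is q.\<close>

lemma smooth_on_matrix_inv_m_tensor: "smooth_on \<Omega> (\<lambda>x. matrix_inv (m_tensor F q x) $ i $ j)"
proof (rule smooth_on_cong[OF open_domain])
  show "inverse (q x) * adjugate (m_tensor F q x) $ i $ j = matrix_inv (m_tensor F q x) $ i $ j"
    if "x \<in> \<Omega>" for x
    using symmetric_point.det_m_tensor[OF symmetric_point[OF that]] q_nonzero[OF that]
    by (simp add: matrix_inv_eq_adjugate)
  show "smooth_on \<Omega> (\<lambda>x. inverse (q x) * adjugate (m_tensor F q x) $ i $ j)"
    by (intro smooth_on_mult smooth_on_inverse smooth_on_adjugate smooth_on_m_tensor open_domain
        smooth_q q_nonzero)
qed

lemma smooth_on_affine_normal: "smooth_on \<Omega> affine_normal"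
  unfolding affine_normal_def[abs_def] k_tensor_def Pi_upper_def vec_lambda_beta
  by (intro smooth_on_vec smooth_on_diff smooth_on_minus smooth_on_mult smooth_on_sum smooth_on_abs_powr
      smooth_on_inverse smooth_on_matrix_inv_m_tensor smooth_on_nth smooth_on_N_field smooth_on_mu
      smooth_on_U_fun open_domain smooth_function U_nonzero smooth_q q_nonzero)

lemma smooth_on_co_orientation: "smooth_on \<Omega> co_orientation"
proof (rule smooth_on_cong[OF open_domain])
  \<comment> \<open>The sign is written as |U| / U; the exponent 1 brings |U| under the smoothness
    rule for powers.\<close>
  show "- ((\<bar>U_fun F x\<bar> powr 1 * inverse (U_fun F x)) *\<^sub>R N_field F x) = co_orientation x" if "x \<in> \<Omega>" for x
    using U_nonzero[OF that] by (simp add: co_orientation_def sgn_if)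
  show "smooth_on \<Omega> (\<lambda>x. - ((\<bar>U_fun F x\<bar> powr 1 * inverse (U_fun F x)) *\<^sub>R N_field F x))"
    by (intro smooth_on_minus smooth_on_scaleR smooth_on_mult smooth_on_abs_powr smooth_on_inverse
        smooth_on_N_field smooth_on_U_fun open_domain smooth_function U_nonzero)
qed

lemma grad_co_orientation: "grad F x \<bullet> co_orientation x = - \<bar>U_fun F x\<bar>"
  by (simp add: co_orientation_def U_fun_eq[symmetric] abs_sgn mult.commute)

text \<open>\<mu> is the logarithmic derivative of |U|^(1/(n+2)), so the power is differentiated as
  the exponential of a multiple of ln |U|.\<close>

lemma abs_U_powr_has_derivative:
  assumes "x \<in> \<Omega>"
  shows "((\<lambda>x. - (\<bar>U_fun F x\<bar> powr (1 / (real CARD('m) + 2)))) has_derivative (\<lambda>u. - (\<bar>U_fun F x\<bar> powr (1 / (real CARD('m) + 2))) * (u \<bullet> mu F x))) (at x)"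
proof -
  define L where "L = (\<lambda>x. ln \<bar>U_fun F x\<bar>)"
  have "smooth_on \<Omega> L"
    unfolding L_def by (intro smooth_on_ln_abs smooth_on_U_fun open_domain smooth_function U_nonzero)
  from smooth_on_grad_has_derivative[OF this assms]
  have "((\<lambda>x. - exp ((1 / (real CARD('m) + 2)) * L x)) has_derivative (\<lambda>u. - (exp ((1 / (real CARD('m) + 2)) * L x) * ((1 / (real CARD('m) + 2)) * (grad L x \<bullet> u))))) (at x)"
    by (auto intro!: derivative_eq_intros)
  moreover have "mu F x = (1 / (real CARD('m) + 2)) *\<^sub>R grad L x"
    by (simp add: L_def mu_def grad_def vec_eq_iff divide_inverse)
  ultimately have *: "((\<lambda>x. - exp ((1 / (real CARD('m) + 2)) * L x)) has_derivative (\<lambda>u. - exp ((1 / (real CARD('m) + 2)) * L x) * (u \<bullet> mu F x))) (at x)"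
    by (simp add: inner_commute)
  have eq: "exp ((1 / (real CARD('m) + 2)) * L y) = \<bar>U_fun F y\<bar> powr (1 / (real CARD('m) + 2))" if "y \<in> \<Omega>" for y
    using U_nonzero[OF that] by (simp add: L_def powr_def)
  show ?thesis
    by (rule has_derivative_transform_within_open[OF *[unfolded eq[OF assms]] open_domain assms])
      (simp only: eq)
qed

text \<open>Both densities are squared and expressed by P = det(N, Y). With a = g \<bullet> T, the
  relation det(T, Y) = (a / U) P gives a^2 P^2 / U^2. The n rows of h each carry a factor -1/a, and
  P^2 = |U| |det(Y_i^T H Y_j)|, so the other square is P^2 / (|a|^n |U|).\<close>

lemma densities_agree_iff:
  assumes p: "p \<in> \<Sigma>" and T: "grad F p \<bullet> T p \<noteq> 0"
  shows "(\<forall>Y :: 'm \<Rightarrow> real ^ 'm option. (\<forall>i. Y i \<in> tangent_space \<Sigma> p) \<longrightarrow>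
        interior_density T p Y = metric_density (second_fundamental_form \<Sigma> T) p Y)
     \<longleftrightarrow> \<bar>grad F p \<bullet> T p\<bar> ^ (CARD('m) + 2) = \<bar>U_fun F p\<bar>"
proof -
  have p\<Omega>: "p \<in> \<Omega>" using p by (simp add: mem_level_set)
  interpret symmetric_point F q p by (rule symmetric_point[OF p\<Omega>])
  define a where "a = g \<bullet> T p"
  define n where "n = CARD('m)"
  have a: "a \<noteq> 0" using T by (simp add: a_def)
  have U: "U \<noteq> 0" using U_nonzero p\<Omega> by simp
  have iff: "interior_density T p Y = metric_density (second_fundamental_form \<Sigma> T) p Y
      \<longleftrightarrow> \<bar>a\<bar> ^ (n + 2) * (Psi (case_option N Y))\<^sup>2 = \<bar>U\<bar> * (Psi (case_option N Y))\<^sup>2"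
    if Y: "\<And>i. Y i \<in> tangent_space \<Sigma> p" for Y :: "'m \<Rightarrow> real ^ 'm option"
  proof -
    let ?P = "Psi (case_option N Y)" and ?D = "det (\<chi> i j. Y i \<bullet> (H *v Y j))"
    have gY: "g \<bullet> Y i = 0" for i using Y tangent_space_eq[OF p] by auto
    have "Psi (case_option (T p) Y) = a / U * ?P"
      by (rule Psi_change_transversal[OF grad_nonzero[OF p\<Omega>] gY]) (use U in \<open>simp add: a_def U_fun_eq\<close>)
    then have I: "(interior_density T p Y)\<^sup>2 = a\<^sup>2 * ?P\<^sup>2 / U\<^sup>2"
      by (simp add: interior_density_def power_divide power_mult_distrib)
    have PD: "?P\<^sup>2 = \<bar>U\<bar> * \<bar>?D\<bar>"
      using arg_cong[OF Psi_N_square[OF gY], of abs] by (simp add: abs_mult)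
    have "(\<chi> i j. second_fundamental_form \<Sigma> T p (Y i) (Y j)) = (\<chi> i j. - inverse a * (Y i \<bullet> (H *v Y j)))"
      using second_fundamental_form_eq[of p T, OF p T Y Y] by (simp add: vec_eq_iff a_def)
    then have "(metric_density (second_fundamental_form \<Sigma> T) p Y)\<^sup>2 = \<bar>inverse a ^ n * ?D\<bar>"
      by (simp only: metric_density_def det_scale_entries) (simp add: n_def abs_mult power_abs)
    also have "\<dots> = ?P\<^sup>2 / (\<bar>a\<bar> ^ n * \<bar>U\<bar>)"
      unfolding PD using U a by (simp add: abs_mult power_abs field_simps)
    finally have m: "(metric_density (second_fundamental_form \<Sigma> T) p Y)\<^sup>2 = ?P\<^sup>2 / (\<bar>a\<bar> ^ n * \<bar>U\<bar>)" .
    have "interior_density T p Y = metric_density (second_fundamental_form \<Sigma> T) p Y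
      \<longleftrightarrow> (interior_density T p Y)\<^sup>2 = (metric_density (second_fundamental_form \<Sigma> T) p Y)\<^sup>2"
      by (subst power2_eq_iff_nonneg) (auto simp: interior_density_def metric_density_def)
    also have "\<dots> \<longleftrightarrow> \<bar>a\<bar>\<^sup>2 * ?P\<^sup>2 / \<bar>U\<bar>\<^sup>2 = ?P\<^sup>2 / (\<bar>a\<bar> ^ n * \<bar>U\<bar>)"
      unfolding I m by simp
    also have "\<dots> \<longleftrightarrow> \<bar>U\<bar> * (\<bar>a\<bar> ^ (n + 2) * ?P\<^sup>2) = \<bar>U\<bar> * (\<bar>U\<bar> * ?P\<^sup>2)"
      using a U by (simp add: frac_eq_eq power_add power2_eq_square mult_ac del: mult_cancel_left abs_mult_self_eq)
    finally show ?thesis using U by simp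
  qed
  \<comment> \<open>Dependent vectors give P = 0 and no information, so recovering the equation from
    the densities takes one tangent frame with P nonzero.\<close>
  obtain v :: "'m \<Rightarrow> real ^ 'm option" where v: "\<And>i. g \<bullet> v i = 0"
    and "\<And>w. g \<bullet> w \<noteq> 0 \<Longrightarrow> Psi (case_option w v) \<noteq> 0"
    using exists_orthogonal_frame[OF grad_nonzero[OF p\<Omega>]] by blast
  then have "Psi (case_option N v) \<noteq> 0" using U by (simp add: U_fun_eq)
  moreover have "v i \<in> tangent_space \<Sigma> p" for i using v tangent_space_eq[OF p] by simp
  ultimately show ?thesis
    using iff unfolding a_def[symmetric] n_def[symmetric] by (metis mult_right_cancel power2_eq_square no_zero_divisors)
qed

lemma abs_U_powr_power: "(\<bar>U_fun F x\<bar> powr (1 / (real CARD('m) + 2))) ^ (CARD('m) + 2) = \<bar>U_fun F x\<bar>" if "x \<in> \<Omega>"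
proof -
  have "(\<bar>U_fun F x\<bar> powr (1 / (real CARD('m) + 2))) ^ (CARD('m) + 2) = \<bar>U_fun F x\<bar> powr ((1 / (real CARD('m) + 2)) * real (CARD('m) + 2))"
    using U_nonzero[OF that] by (simp only: powr_powr[symmetric] powr_realpow zero_less_abs_iff powr_gt_zero)
  then show ?thesis using U_nonzero[OF that] by (simp add: field_simps)
qed

text \<open>The function g \<bullet> T is the same on \<Sigma> for T and for W, and its derivative
  along u is u^T H W. The product rule turns the obstruction to parallelism into the Hessian pairing
  of u with W - T. Taking T = W gives existence; a competitor without obstruction gives
  uniqueness.\<close>

lemma grad_affine_normal_deriv:
  assumes p: "p \<in> \<Sigma>" and u: "u \<in> tangent_space \<Sigma> p" and L: "(T has_derivative L) (at p within \<Sigma>)"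
    and gT: "\<And>x. x \<in> \<Sigma> \<Longrightarrow> grad F x \<bullet> T x = - (\<bar>U_fun F x\<bar> powr (1 / (real CARD('m) + 2)))"
  shows "grad F p \<bullet> flat_deriv \<Sigma> T p u = u \<bullet> (hess F p *v affine_normal p) - u \<bullet> (hess F p *v T p)"
proof -
  have p\<Omega>: "p \<in> \<Omega>" using p by (simp add: mem_level_set)
  have "((\<lambda>x. grad F x \<bullet> T x) has_derivative (\<lambda>u. - (\<bar>U_fun F p\<bar> powr (1 / (real CARD('m) + 2))) * (u \<bullet> mu F p))) (at p within \<Sigma>)"
    by (rule has_derivative_transform_openin[OF openin_level_set p
          has_derivative_at_withinI[OF abs_U_powr_has_derivative[OF p\<Omega>]]]) (simp add: gT)
  from flat_deriv_eq[OF u this] grad_inner_field_deriv[OF p u L]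
  show ?thesis using hess_affine_normal[OF p\<Omega>] u by (simp add: tangent_space_eq[OF p])
qed

lemma transversal_if_grad_nonzero:
  assumes "smooth_on \<Omega> T" "\<And>x. x \<in> \<Omega> \<Longrightarrow> grad F x \<bullet> T x \<noteq> 0"
  shows "transversal \<Sigma> T"
  unfolding transversal_iff
  using assms(2) smooth_on_imp_smooth_along[OF open_domain _ assms(1), of \<Sigma>]
  by (simp add: mem_level_set subset_iff)

lemma transversal_affine_normal: "transversal \<Sigma> affine_normal"
  by (rule transversal_if_grad_nonzero[OF smooth_on_affine_normal])
    (simp add: grad_affine_normal U_nonzero)

lemma transversal_co_orientation: "transversal \<Sigma> co_orientation"
  by (rule transversal_if_grad_nonzero[OF smooth_on_co_orientation])
    (simp add: grad_co_orientation U_nonzero)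

lemma equiaffine_transversal_affine_normal: "equiaffine_transversal \<Sigma> co_orientation affine_normal"
  unfolding equiaffine_transversal_def
proof (intro conjI)
  show "transversal \<Sigma> affine_normal" by (rule transversal_affine_normal)
  show "co_oriented \<Sigma> co_orientation affine_normal"
    unfolding co_oriented_def
  proof
    fix p assume p: "p \<in> \<Sigma>"
    then have "p \<in> \<Omega>" by (simp add: mem_level_set)
    \<comment> \<open>The witness is the quotient of the pairings of W and of the co-orientation
      with the gradient.\<close>
    then show "\<exists>c>0. affine_normal p - c *\<^sub>R co_orientation p \<in> tangent_space \<Sigma> p"
      using U_nonzero
      by (intro exI[of _ "\<bar>U_fun F p\<bar> powr (1 / (real CARD('m) + 2)) / \<bar>U_fun F p\<bar>"])
        (simp add: tangent_space_eq[OF p] inner_diff_right grad_affine_normal grad_co_orientation)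
  qed
  show "\<forall>p\<in>\<Sigma>. \<forall>Y :: 'm \<Rightarrow> real ^ 'm option. (\<forall>i. Y i \<in> tangent_space \<Sigma> p) \<longrightarrow>
      interior_density affine_normal p Y = metric_density (second_fundamental_form \<Sigma> affine_normal) p Y"
  proof
    fix p assume p: "p \<in> \<Sigma>"
    then have "p \<in> \<Omega>" by (simp add: mem_level_set)
    then have "grad F p \<bullet> affine_normal p \<noteq> 0"
      and "\<bar>grad F p \<bullet> affine_normal p\<bar> = \<bar>U_fun F p\<bar> powr (1 / (real CARD('m) + 2))"
      and "(\<bar>U_fun F p\<bar> powr (1 / (real CARD('m) + 2))) ^ (CARD('m) + 2) = \<bar>U_fun F p\<bar>"
      using U_nonzero abs_U_powr_power by (simp_all only: grad_affine_normal) simp_all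
    then have "grad F p \<bullet> affine_normal p \<noteq> 0"
      "\<bar>grad F p \<bullet> affine_normal p\<bar> ^ (CARD('m) + 2) = \<bar>U_fun F p\<bar>" by simp_all
    then show "\<forall>Y :: 'm \<Rightarrow> real ^ 'm option. (\<forall>i. Y i \<in> tangent_space \<Sigma> p) \<longrightarrow>
        interior_density affine_normal p Y = metric_density (second_fundamental_form \<Sigma> affine_normal) p Y"
      using densities_agree_iff[OF p] by blast
  qed
  show "parallel_density \<Sigma> affine_normal (interior_density affine_normal)"
    unfolding parallel_density_iff[OF transversal_affine_normal]
  proof (intro ballI)
    fix p u assume p: "p \<in> \<Sigma>" and u: "u \<in> tangent_space \<Sigma> p"
    obtain L where "(affine_normal has_derivative L) (at p within \<Sigma>)"
      using smooth_along_has_derivative[OF openin_level_set _ p] transversal_affine_normal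
      by (auto simp: transversal_def)
    from grad_affine_normal_deriv[OF p u this] show "grad F p \<bullet> flat_deriv \<Sigma> affine_normal p u = 0"
      by (simp add: grad_affine_normal mem_level_set)
  qed
qed

lemma equiaffine_transversal_unique:
  assumes "equiaffine_transversal \<Sigma> co_orientation W'" "p \<in> \<Sigma>"
  shows "W' p = affine_normal p"
proof -
  have tr: "transversal \<Sigma> W'" and co: "co_oriented \<Sigma> co_orientation W'"
    and dens: "\<forall>p\<in>\<Sigma>. \<forall>Y :: 'm \<Rightarrow> real ^ 'm option. (\<forall>i. Y i \<in> tangent_space \<Sigma> p) \<longrightarrow>
      interior_density W' p Y = metric_density (second_fundamental_form \<Sigma> W') p Y"
    and par: "parallel_density \<Sigma> W' (interior_density W')"
    using assms(1) by (auto simp: equiaffine_transversal_def)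
  have gW': "grad F x \<bullet> W' x = - (\<bar>U_fun F x\<bar> powr (1 / (real CARD('m) + 2)))" if x: "x \<in> \<Sigma>" for x
  proof -
    have x\<Omega>: "x \<in> \<Omega>" using x by (simp add: mem_level_set)
    \<comment> \<open>The co-orientation decides only the sign of the pairing; its size comes from
      the densities.\<close>
    obtain c where c: "c > 0" "grad F x \<bullet> (W' x - c *\<^sub>R co_orientation x) = 0"
      using co x tangent_space_eq[OF x] by (auto simp: co_oriented_def)
    then have "grad F x \<bullet> W' x = - (c * \<bar>U_fun F x\<bar>)"
      by (simp add: inner_diff_right grad_co_orientation)
    moreover have "0 < c * \<bar>U_fun F x\<bar>" using c(1) U_nonzero[OF x\<Omega>] by simp
    ultimately have neg: "grad F x \<bullet> W' x < 0" by linarith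
    then have pow: "\<bar>grad F x \<bullet> W' x\<bar> ^ (CARD('m) + 2) = \<bar>U_fun F x\<bar>"
      using densities_agree_iff[OF x, of W'] dens x by simp
    have "\<bar>grad F x \<bullet> W' x\<bar> = \<bar>U_fun F x\<bar> powr (1 / (real CARD('m) + 2))"
      by (rule power_eq_imp_eq_base[OF trans[OF pow abs_U_powr_power[OF x\<Omega>, symmetric]]]) simp_all
    with neg show ?thesis by simp
  qed
  have p\<Omega>: "p \<in> \<Omega>" using assms(2) by (simp add: mem_level_set)
  obtain L where L: "(W' has_derivative L) (at p within \<Sigma>)"
    using smooth_along_has_derivative[OF openin_level_set _ assms(2)] tr by (auto simp: transversal_def)
  interpret symmetric_point F q p by (rule symmetric_point[OF p\<Omega>])
  \<comment> \<open>Equal pairings with g make the difference tangent, and parallelism of both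
    densities makes it H-orthogonal to the tangent space.\<close>
  have "affine_normal p - W' p = 0"
  proof (rule hess_nondegenerate)
    show "g \<bullet> (affine_normal p - W' p) = 0"
      using gW'[OF assms(2)] grad_affine_normal[OF p\<Omega>] by (simp add: inner_diff_right)
    fix u assume "g \<bullet> u = 0"
    then have u: "u \<in> tangent_space \<Sigma> p" by (simp add: tangent_space_eq[OF assms(2)])
    then have "g \<bullet> flat_deriv \<Sigma> W' p u = 0"
      using par assms(2) unfolding parallel_density_iff[OF tr] by blast
    then show "u \<bullet> (H *v (affine_normal p - W' p)) = 0"
      using grad_affine_normal_deriv[OF assms(2) u L gW']
      by (simp add: matrix_vector_mult_diff_distrib inner_diff_right)
  qed
  then show ?thesis by simp
qed

lemma nondegenerate_level_set: "nondegenerate \<Sigma> co_orientation"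
  unfolding nondegenerate_def
proof (intro ballI impI)
  fix p u assume p: "p \<in> \<Sigma>" and u: "u \<in> tangent_space \<Sigma> p"
    and 0: "\<forall>v\<in>tangent_space \<Sigma> p. second_fundamental_form \<Sigma> co_orientation p u v = 0"
  have p\<Omega>: "p \<in> \<Omega>" using p by (simp add: mem_level_set)
  then have nz: "grad F p \<bullet> co_orientation p \<noteq> 0" by (simp add: grad_co_orientation U_nonzero)
  interpret symmetric_point F q p by (rule symmetric_point[OF p\<Omega>])
  show "u = 0"
  proof (rule hess_nondegenerate)
    show "g \<bullet> u = 0" using u by (simp add: tangent_space_eq[OF p])
    fix v assume "g \<bullet> v = 0"
    then have v: "v \<in> tangent_space \<Sigma> p" by (simp add: tangent_space_eq[OF p])
    then show "v \<bullet> (H *v u) = 0"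
      using 0 second_fundamental_form_eq[of p co_orientation, OF p nz u v] nz
        inner_matrix_vector_symmetric[OF symmetric_point.hess_sym[OF symmetric_point[OF p\<Omega>]], of v u]
      by auto
  qed
qed

theorem is_equiaffine_normal_affine_normal: "is_equiaffine_normal \<Sigma> co_orientation affine_normal"
  unfolding is_equiaffine_normal_def
  using hypersurface_level_set transversal_co_orientation nondegenerate_level_set
    equiaffine_transversal_affine_normal equiaffine_transversal_unique by blast

end

theorem theorem2p15:
  fixes D \<Omega> :: "(real ^ ('m::finite option)) set"
    and F q :: "real ^ ('m option) \<Rightarrow> real"
    and r :: real
  assumes "open D" and "smooth_on D F"
    and "\<Omega> \<in> components {x \<in> D. U_fun F x \<noteq> 0}" and "interior \<Omega> \<noteq> {}"
    and "smooth_on \<Omega> q" and "\<forall>x\<in>\<Omega>. q x \<noteq> 0"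
    and "level_set F \<Omega> r \<noteq> {}"
  shows "is_equiaffine_normal (level_set F \<Omega> r)
           (\<lambda>x. - sgn (U_fun F x) *\<^sub>R N_field F x)
           (\<lambda>x. \<chi> i. - (\<bar>U_fun F x\<bar> powr (1 / (real CARD('m) + 2)) * inverse (U_fun F x) * N_field F x $ i)
                     - (\<Sum>p\<in>UNIV. k_tensor F q x $ i $ p * mu F x $ p))"
proof -
  have "open (D \<inter> U_fun F -` (- {0}))"
    by (rule continuous_open_preimage[OF smooth_on_continuous_on[OF smooth_on_U_fun] assms(1)])
      (use assms in auto)
  moreover have "D \<inter> U_fun F -` (- {0}) = {x \<in> D. U_fun F x \<noteq> 0}" by auto
  ultimately have "open \<Omega>" using assms(3) open_components by metis
  have sub: "\<Omega> \<subseteq> {x \<in> D. U_fun F x \<noteq> 0}" by (rule in_components_subset[OF assms(3)])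
  interpret equiaffine_function \<Omega> F q r
  proof
    show "smooth_on \<Omega> F" by (rule smooth_on_subset[OF assms(2)]) (use sub in auto)
  qed (use \<open>open \<Omega>\<close> sub assms in auto)
  show ?thesis
    using is_equiaffine_normal_affine_normal
    by (simp only: co_orientation_def[abs_def] affine_normal_def[abs_def])
qed

end
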